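(* Let $(W,S)$ be a Coxeter system. If $n(s,t)<\infty$ for all $s,t\in S$ and $\Gamma$ is a connected $W$-digraph, then the following hold. (i) $\Gamma$ can have at most one source and at most one sink. (ii) If $\Gamma$ has either a source or a sink, then $\Gamma$ is acyclic. (iii) If $(W,S)$ is finite, then $\Gamma$ has both a source and a sink, and so is acyclic.
   Context: Coxeter system: $W$ has presentation $\langle s\in S\mid (rs)^{n(r,s)}=e \text{ for } r,s\in S,\ n(r,s)<\infty\rangle$ with $n(s,s)=1$ and $1<n(r,s)=n(s,r)\le\infty$ for $r\ne s$; $\ell$ is the length function. "$(W,S)$ is finite" means $W$ is finite. Hecke algebra: $u$ is an indeterminate and $H$ is the $\mathbb Q(u)$-algebra with basis $\{T_w\mid w\in W\}$ satisfying, for $s\in S$, $T_sT_w=T_{sw}$ if $\ell(sw)>\ell(w)$ and $T_sT_w=u^2T_{sw}+(u^2-1)T_w$ if $\ell(sw)<\ell(w)$. An $S$-labeled digraph is a directed multigraph $\Gamma$ with vertex set $\mathscr V(\Gamma)$ and edge set $\mathscr E(\Gamma)$, in which every edge is either solid or dashed and is labeled by an element of $S$ (written $\alpha\xrightarrow{s}\beta$ if solid, $\alpha\overset{s}{\dashrightarrow}\beta$ if dashed), such that $\Gamma$ has no loops and, for each $s\in S$, every vertex occurs in exactly one edge labeled $s$. Let $M(\Gamma)$ be the $\mathbb Q(u)$-vector space with basis $\mathscr V(\Gamma)$. For $s\in S$ let $\tau_s$ be the linear operator on $M(\Gamma)$ with, for each vertex $\alpha$ (where $\beta$ is the other endpoint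 of the edge labeled $s$ at $\alpha$): $\tau_s(\alpha)=\beta$ if the edge is $\alpha\xrightarrow{s}\beta$; $\tau_s(\alpha)=(u^2-1)\alpha+u^2\beta$ if it is $\beta\xrightarrow{s}\alpha$; $\tau_s(\alpha)=u\alpha+(u+1)\beta$ if it is $\alpha\overset{s}{\dashrightarrow}\beta$; $\tau_s(\alpha)=(u^2-u-1)\alpha+(u^2-u)\beta$ if it is $\beta\overset{s}{\dashrightarrow}\alpha$. An $S$-labeled digraph $\Gamma$ is a $W$-digraph if $T_s\mapsto\tau_s$ ($s\in S$) extends to a homomorphism of $\mathbb Q(u)$-algebras from $H$ to the algebra of all linear operators on $M(\Gamma)$. Ignoring types and labels of edges gives a directed multigraph: a source (sink) of $\Gamma$ is a vertex with no incoming (no outgoing) edges; $\Gamma$ is acyclic if it has no nonempty directed circuit; $\Gamma$ is connected if the underlying undirected multigraph is connected. *)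

theory Defs
  imports
    "HOL-Library.Extended_Nat"
    "HOL-Library.Poly_Mapping"
    "HOL-Computational_Algebra.Fraction_Field"
    "HOL-Computational_Algebra.Polynomial"
    "HOL-Algebra.Module"
    "HOL-Algebra.Algebraic_Closure_Type"
    "Graph_Theory.Arc_Walk"
    "Graph_Theory.Digraph_Component"
begin

section \<open>Group presentations and Coxeter systems\<close>

text \<open>A letter \<open>(x, True)\<close> stands for the generator \<open>x\<close>, a letter \<open>(x, False)\<close> for its
  formal inverse.\<close>

type_synonym 'a word = "('a \<times> bool) list"

definition words :: "'a set \<Rightarrow> 'a word set" where
  "words A = lists (A \<times> UNIV)"

definition word_value :: "('a, 'm) monoid_scheme \<Rightarrow> 'a word \<Rightarrow> 'a" where
  "word_value G w =
     foldr (\<lambda>(x, b) g. (if b then x else inv\<^bsub>G\<^esub> x) \<otimes>\<^bsub>G\<^esub> g) w \<one>\<^bsub>G\<^esub>"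

text \<open>Equality of words in the group \<open>\<langle>A | R\<rangle>\<close>: the least congruence for concatenation that
  cancels adjacent mutually inverse letters and kills all relators.\<close>

inductive presented_eq :: "'a set \<Rightarrow> 'a word set \<Rightarrow> 'a word \<Rightarrow> 'a word \<Rightarrow> bool"
  for A :: "'a set" and R :: "'a word set" where
  refl: "w \<in> words A \<Longrightarrow> presented_eq A R w w"
| sym: "presented_eq A R v w \<Longrightarrow> presented_eq A R w v"
| trans: "presented_eq A R v w \<Longrightarrow> presented_eq A R w w' \<Longrightarrow> presented_eq A R v w'"
| cancel: "v \<in> words A \<Longrightarrow> w \<in> words A \<Longrightarrow> x \<in> A \<Longrightarrow>
    presented_eq A R (v @ [(x, b), (x, \<not> b)] @ w) (v @ w)"
| relator: "v \<in> words A \<Longrightarrow> w \<in> words A \<Longrightarrow> r \<in> R \<Longrightarrow> r \<in> words A \<Longrightarrow>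
    presented_eq A R (v @ r @ w) (v @ w)"

definition has_presentation :: "('a, 'm) monoid_scheme \<Rightarrow> 'a set \<Rightarrow> 'a word set \<Rightarrow> bool" where
  "has_presentation G A R \<longleftrightarrow>
     A \<subseteq> carrier G \<and>
     word_value G ` words A = carrier G \<and>
     (\<forall>v \<in> words A. \<forall>w \<in> words A.
        word_value G v = word_value G w \<longleftrightarrow> presented_eq A R v w)"

definition coxeter_relators :: "'a set \<Rightarrow> ('a \<Rightarrow> 'a \<Rightarrow> enat) \<Rightarrow> 'a word set" where
  "coxeter_relators S n =
     {concat (replicate k [(r, True), (s, True)]) | r s k. r \<in> S \<and> s \<in> S \<and> n r s = enat k}"

locale coxeter_system = group W
  for W :: "('w, 'm) monoid_scheme" (structure) +
  fixes S :: "'w set" and n :: "'w \<Rightarrow> 'w \<Rightarrow> enat"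
  assumes n_diag: "s \<in> S \<Longrightarrow> n s s = 1"
    and n_offdiag: "r \<in> S \<Longrightarrow> s \<in> S \<Longrightarrow> r \<noteq> s \<Longrightarrow> 1 < n r s"
    and n_sym: "r \<in> S \<Longrightarrow> s \<in> S \<Longrightarrow> n r s = n s r"
    and presentation: "has_presentation W S (coxeter_relators S n)"

definition coxeter_length :: "('w, 'm) monoid_scheme \<Rightarrow> 'w set \<Rightarrow> 'w \<Rightarrow> nat" where
  "coxeter_length W S w =
     (LEAST k. \<exists>xs \<in> lists S. length xs = k \<and> foldr (\<otimes>\<^bsub>W\<^esub>) xs \<one>\<^bsub>W\<^esub> = w)"


section \<open>Algebras over the field of rational functions\<close>

type_synonym ratfun = "rat poly fract"

definition u :: ratfun where
  "u = Fract [:0, 1:] 1"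

abbreviation Qu :: "ratfun ring" where
  "Qu \<equiv> ring_of_type_algebra"

text \<open>The library's locale \<open>algebra\<close> is restricted to commutative algebras.\<close>

locale assoc_algebra = Module.module R A + A?: ring A
  for R (structure) and A (structure) +
  assumes smult_mult_left: "a \<in> carrier R \<Longrightarrow> x \<in> carrier A \<Longrightarrow> y \<in> carrier A \<Longrightarrow>
      (a \<odot>\<^bsub>A\<^esub> x) \<otimes>\<^bsub>A\<^esub> y = a \<odot>\<^bsub>A\<^esub> (x \<otimes>\<^bsub>A\<^esub> y)"
    and smult_mult_right: "a \<in> carrier R \<Longrightarrow> x \<in> carrier A \<Longrightarrow> y \<in> carrier A \<Longrightarrow>
      x \<otimes>\<^bsub>A\<^esub> (a \<odot>\<^bsub>A\<^esub> y) = a \<odot>\<^bsub>A\<^esub> (x \<otimes>\<^bsub>A\<^esub> y)"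

definition algebra_hom ::
  "('k, 'r) ring_scheme \<Rightarrow> ('k, 'a, 'm) module_scheme \<Rightarrow> ('k, 'b, 'n) module_scheme \<Rightarrow>
   ('a \<Rightarrow> 'b) set" where
  "algebra_hom R A B =
     {\<phi> \<in> ring_hom A B.
        \<forall>c \<in> carrier R. \<forall>x \<in> carrier A. \<phi> (c \<odot>\<^bsub>A\<^esub> x) = c \<odot>\<^bsub>B\<^esub> \<phi> x}"

definition is_basis ::
  "('k, 'r) ring_scheme \<Rightarrow> ('k, 'a, 'm) module_scheme \<Rightarrow> 'i set \<Rightarrow> ('i \<Rightarrow> 'a) \<Rightarrow> bool" where
  "is_basis R M I b \<longleftrightarrow>
     (\<forall>i \<in> I. b i \<in> carrier M) \<and>
     (\<forall>x \<in> carrier M. \<exists>!c. c \<in> I \<rightarrow>\<^sub>E carrier R \<and> finite {i \<in> I. c i \<noteq> \<zero>\<^bsub>R\<^esub>} \<and>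
        x = (\<Oplus>\<^bsub>M\<^esub>i \<in> {i \<in> I. c i \<noteq> \<zero>\<^bsub>R\<^esub>}. c i \<odot>\<^bsub>M\<^esub> b i))"

definition linear_operators ::
  "('k, 'r) ring_scheme \<Rightarrow> ('k, 'a, 'm) module_scheme \<Rightarrow> ('a \<Rightarrow> 'a) set" where
  "linear_operators R M =
     {f \<in> carrier M \<rightarrow>\<^sub>E carrier M.
        (\<forall>x \<in> carrier M. \<forall>y \<in> carrier M. f (x \<oplus>\<^bsub>M\<^esub> y) = f x \<oplus>\<^bsub>M\<^esub> f y) \<and>
        (\<forall>c \<in> carrier R. \<forall>x \<in> carrier M. f (c \<odot>\<^bsub>M\<^esub> x) = c \<odot>\<^bsub>M\<^esub> f x)}"

definition End_algebra ::
  "('k, 'r) ring_scheme \<Rightarrow> ('k, 'a, 'm) module_scheme \<Rightarrow> ('k, 'a \<Rightarrow> 'a) module" where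
  "End_algebra R M =
     \<lparr> carrier = linear_operators R M,
       monoid.mult = compose (carrier M),
       monoid.one = (\<lambda>x \<in> carrier M. x),
       ring.zero = (\<lambda>x \<in> carrier M. \<zero>\<^bsub>M\<^esub>),
       ring.add = (\<lambda>f g. \<lambda>x \<in> carrier M. f x \<oplus>\<^bsub>M\<^esub> g x),
       module.smult = (\<lambda>c f. \<lambda>x \<in> carrier M. c \<odot>\<^bsub>M\<^esub> f x) \<rparr>"


section \<open>Hecke algebras\<close>

text \<open>\<open>H\<close> with the family \<open>T\<close> is determined up to unique isomorphism by these axioms.\<close>

locale hecke_algebra = assoc_algebra Qu H
  for W :: "('w, 'm) monoid_scheme" and S :: "'w set"
    and H :: "(ratfun, 'h) module" and T :: "'w \<Rightarrow> 'h" +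
  assumes basis: "is_basis Qu H (carrier W) T"
    and T_mult_up: "s \<in> S \<Longrightarrow> w \<in> carrier W \<Longrightarrow>
      coxeter_length W S (s \<otimes>\<^bsub>W\<^esub> w) > coxeter_length W S w \<Longrightarrow>
      T s \<otimes>\<^bsub>H\<^esub> T w = T (s \<otimes>\<^bsub>W\<^esub> w)"
    and T_mult_down: "s \<in> S \<Longrightarrow> w \<in> carrier W \<Longrightarrow>
      coxeter_length W S (s \<otimes>\<^bsub>W\<^esub> w) < coxeter_length W S w \<Longrightarrow>
      T s \<otimes>\<^bsub>H\<^esub> T w = u^2 \<odot>\<^bsub>H\<^esub> T (s \<otimes>\<^bsub>W\<^esub> w) \<oplus>\<^bsub>H\<^esub> (u^2 - 1) \<odot>\<^bsub>H\<^esub> T w"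


section \<open>Labeled digraphs\<close>

text \<open>The label and the dashed/solid type of an edge are only relevant on the edges of the
  underlying directed multigraph.\<close>

record ('v, 'e, 's) labeled_digraph =
  underlying :: "('v, 'e) pre_digraph"
  label :: "'e \<Rightarrow> 's"
  dashed :: "'e \<Rightarrow> bool"

abbreviation vertices :: "('v, 'e, 's) labeled_digraph \<Rightarrow> 'v set" where
  "vertices \<Gamma> \<equiv> verts (underlying \<Gamma>)"

abbreviation edges :: "('v, 'e, 's) labeled_digraph \<Rightarrow> 'e set" where
  "edges \<Gamma> \<equiv> arcs (underlying \<Gamma>)"

abbreviation source_of :: "('v, 'e, 's) labeled_digraph \<Rightarrow> 'e \<Rightarrow> 'v" where
  "source_of \<Gamma> \<equiv> tail (underlying \<Gamma>)"

abbreviation target_of :: "('v, 'e, 's) labeled_digraph \<Rightarrow> 'e \<Rightarrow> 'v" where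
  "target_of \<Gamma> \<equiv> head (underlying \<Gamma>)"

definition edge_at :: "('v, 'e, 's) labeled_digraph \<Rightarrow> 's \<Rightarrow> 'v \<Rightarrow> 'e \<Rightarrow> bool" where
  "edge_at \<Gamma> s \<alpha> e \<longleftrightarrow>
     e \<in> edges \<Gamma> \<and> label \<Gamma> e = s \<and> (source_of \<Gamma> e = \<alpha> \<or> target_of \<Gamma> e = \<alpha>)"

definition S_labeled_digraph :: "'s set \<Rightarrow> ('v, 'e, 's) labeled_digraph \<Rightarrow> bool" where
  "S_labeled_digraph S \<Gamma> \<longleftrightarrow>
     loopfree_digraph (underlying \<Gamma>) \<and>
     (\<forall>e \<in> edges \<Gamma>. label \<Gamma> e \<in> S) \<and>
     (\<forall>s \<in> S. \<forall>\<alpha> \<in> vertices \<Gamma>. \<exists>!e. edge_at \<Gamma> s \<alpha> e)"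

text \<open>\<open>M(\<Gamma>)\<close>: formal finite linear combinations of vertices, the vertex \<open>\<alpha>\<close> being
  \<open>Poly_Mapping.single \<alpha> 1\<close>. The fields \<open>mult\<close> and \<open>one\<close> of the record play no role for a module.\<close>

definition vertex_module :: "('v, 'e, 's) labeled_digraph \<Rightarrow> (ratfun, 'v \<Rightarrow>\<^sub>0 ratfun) module" where
  "vertex_module \<Gamma> =
     \<lparr> carrier = {x. Poly_Mapping.keys x \<subseteq> vertices \<Gamma>},
       monoid.mult = (\<lambda>_ _. undefined),
       monoid.one = undefined,
       ring.zero = 0,
       ring.add = (+),
       module.smult = (\<lambda>c. Poly_Mapping.map ((*) c)) \<rparr>"

definition tau_vertex :: "('v, 'e, 's) labeled_digraph \<Rightarrow> 's \<Rightarrow> 'v \<Rightarrow> 'v \<Rightarrow>\<^sub>0 ratfun" where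
  "tau_vertex \<Gamma> s \<alpha> =
     (let e = (THE e. edge_at \<Gamma> s \<alpha> e) in
      if source_of \<Gamma> e = \<alpha> then
        (let \<beta> = target_of \<Gamma> e in
         if dashed \<Gamma> e
         then Poly_Mapping.single \<alpha> u + Poly_Mapping.single \<beta> (u + 1)
         else Poly_Mapping.single \<beta> 1)
      else
        (let \<beta> = source_of \<Gamma> e in
         if dashed \<Gamma> e
         then Poly_Mapping.single \<alpha> (u^2 - u - 1) + Poly_Mapping.single \<beta> (u^2 - u)
         else Poly_Mapping.single \<alpha> (u^2 - 1) + Poly_Mapping.single \<beta> (u^2)))"

definition tau ::
  "('v, 'e, 's) labeled_digraph \<Rightarrow> 's \<Rightarrow> ('v \<Rightarrow>\<^sub>0 ratfun) \<Rightarrow> ('v \<Rightarrow>\<^sub>0 ratfun)" where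
  "tau \<Gamma> s =
     (\<lambda>x \<in> carrier (vertex_module \<Gamma>).
        \<Sum>\<alpha> \<in> Poly_Mapping.keys x.
          Poly_Mapping.lookup x \<alpha> \<odot>\<^bsub>vertex_module \<Gamma>\<^esub> tau_vertex \<Gamma> s \<alpha>)"

definition W_digraph ::
  "'w set \<Rightarrow> (ratfun, 'h) module \<Rightarrow> ('w \<Rightarrow> 'h) \<Rightarrow> ('v, 'e, 'w) labeled_digraph \<Rightarrow> bool" where
  "W_digraph S H T \<Gamma> \<longleftrightarrow>
     S_labeled_digraph S \<Gamma> \<and>
     (\<exists>\<phi> \<in> algebra_hom Qu H (End_algebra Qu (vertex_module \<Gamma>)). \<forall>s \<in> S. \<phi> (T s) = tau \<Gamma> s)"

definition is_source :: "('v, 'e, 's) labeled_digraph \<Rightarrow> 'v \<Rightarrow> bool" where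
  "is_source \<Gamma> \<alpha> \<longleftrightarrow> \<alpha> \<in> vertices \<Gamma> \<and> in_arcs (underlying \<Gamma>) \<alpha> = {}"

definition is_sink :: "('v, 'e, 's) labeled_digraph \<Rightarrow> 'v \<Rightarrow> bool" where
  "is_sink \<Gamma> \<alpha> \<longleftrightarrow> \<alpha> \<in> vertices \<Gamma> \<and> out_arcs (underlying \<Gamma>) \<alpha> = {}"

definition acyclic_digraph :: "('v, 'e, 's) labeled_digraph \<Rightarrow> bool" where
  "acyclic_digraph \<Gamma> \<longleftrightarrow> \<not> (\<exists>\<alpha> p. pre_digraph.awalk (underlying \<Gamma>) \<alpha> p \<alpha> \<and> p \<noteq> [])"

text \<open>The library's \<open>connected\<close> includes nonemptiness of the vertex set.\<close>

definition connected_digraph :: "('v, 'e, 's) labeled_digraph \<Rightarrow> bool" where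
  "connected_digraph \<Gamma> \<longleftrightarrow> Digraph_Component.connected (underlying \<Gamma>)"

end

theory Submission
  imports Defs
begin

text \<open>
  The matrix entries of the operators \<open>\<tau>\<^sub>s\<close> are polynomials in \<open>u\<close>, so every relation that
  they inherit from the Hecke algebra can be specialized to a rational value \<open>q\<close> of \<open>u\<close>
  (\<open>specialize\<close>). Two values carry the proof.

  At \<open>q = 0\<close> solid and dashed edges act alike: an edge \<open>\<alpha> \<rightarrow> \<beta>\<close> labeled \<open>s\<close> gives
  \<open>\<tau>\<^sub>s \<alpha> = \<beta>\<close> and \<open>\<tau>\<^sub>s \<beta> = - \<beta>\<close>. Up to sign, a word in the generators pushes a vertex along
  edges and leaves it in place when the next edge points the wrong way. Comparing the two
  sides of the braid relation for labels \<open>r, s\<close> at a vertex with both edges outgoing shows that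
  the two alternating paths from this vertex meet (\<open>alternating_meet\<close>). Comparing them at a
  vertex with only one of the two edges outgoing shows, by the signs, that the alternating path
  from it has fewer edges than the relation has letters on each side; so walking backwards
  from a vertex where both edges come in, one finds a vertex from which both alternating paths lead to it (\<open>step_codiamond\<close>).

  At \<open>q = 2\<close> these two paths are seen to have the same length. The sum of the \<open>T\<^sub>w\<close> over the
  dihedral group generated by \<open>r\<close> and \<open>s\<close> gives a linear functional \<open>f\<close> with
  \<open>f (\<tau>\<^sub>r x) = f (\<tau>\<^sub>s x) = q\<^sup>2 f x\<close>. Its values get multiplied by 4 along a solid edge and by
  2/3 along a dashed edge, so two paths with labels \<open>r, s\<close> and the same ends have equally
  many edges of each kind (\<open>ascending_same_length\<close>).

  Hence the edge relation and its converse are both locally confluent with joins of equal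
  length. For such a relation, if one point of a connected component is irreducible, then all
  points of the component reduce to it, and all reductions of a given point have the same
  length (\<open>balanced_normal_form_step\<close>). This gives uniqueness of sources and sinks, and a rank
  function that excludes circuits.

  Finally, again by \<open>q = 0\<close>, the labels along a directed path form a reduced word: if \<open>s\<close>
  shortens \<open>w\<close>, then \<open>T\<^sub>s T\<^sub>w = u\<^sup>2 T\<^sub>s\<^sub>w + (u\<^sup>2 - 1) T\<^sub>w\<close> specializes to \<open>\<tau>\<^sub>s \<tau>\<^sub>w = - \<tau>\<^sub>w\<close>, and the path
  could not continue with label \<open>s\<close>. If \<open>W\<close> is finite, directed paths therefore have bounded
  length, and maximal ones begin at a source and end at a sink.

  The braid relation between \<open>\<tau>\<^sub>r\<close> and \<open>\<tau>\<^sub>s\<close> holds with \<open>m\<close> letters on each side, \<open>m\<close> being the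
  order of \<open>r s\<close>, because the alternating words of length \<open>m\<close> are reduced expressions of one
  group element (\<open>reduced_alternating\<close>). Finiteness of \<open>n(r,s)\<close> makes \<open>m\<close> positive in the
  convention that an element of infinite order has order 0.
\<close>

section \<open>Alternating words in a Coxeter group\<close>

fun alternating :: "'a \<Rightarrow> 'a \<Rightarrow> nat \<Rightarrow> 'a list" where
  "alternating a b 0 = []"
| "alternating a b (Suc k) = a # alternating b a k"

lemma length_alternating [simp]: "length (alternating a b k) = k"
  by (induction k arbitrary: a b) auto

lemma set_alternating: "set (alternating a b k) \<subseteq> {a, b}"
  by (induction k arbitrary: a b) force+

lemma alternating_snoc:
  "alternating a b (Suc k) = alternating a b k @ [if even k then a else b]"
  by (induction k arbitrary: a b) auto

lemma rev_alternating:
  "rev (alternating a b k) = (if odd k then alternating a b k else alternating b a k)"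
proof (induction k arbitrary: a b)
  case (Suc k)
  have "rev (alternating a b (Suc k)) = rev (alternating b a k) @ [a]"
    by simp
  also have "\<dots> = (if odd (Suc k) then alternating a b (Suc k) else alternating b a (Suc k))"
    unfolding Suc.IH alternating_snoc by simp
  finally show ?case .
qed simp

lemma concat_replicate_alternating:
  "concat (replicate k [a, b]) = alternating a b (2 * k)"
  by (induction k) auto

text \<open>Applied to lists of reflections, this bounds the length of every word for a group
  element from below by the length of a single word whose reflections are distinct.\<close>

lemma length_le_if_count_list_parity:
  assumes "distinct xs" and "\<And>x. even (count_list xs x) \<longleftrightarrow> even (count_list ys x)"
  shows "length xs \<le> length ys"
proof -
  have "x \<in> set ys" if "x \<in> set xs" for x
  proof (rule ccontr)
    assume "x \<notin> set ys"
    then have "count_list ys x = 0" by simp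
    moreover have "count_list xs x = 1"
      using assms(1) that by (induction xs) auto
    ultimately show False using assms(2)[of x] by simp
  qed
  then have "card (set xs) \<le> card (set ys)"
    by (intro card_mono) auto
  also have "\<dots> \<le> length ys" by (rule card_length)
  finally show ?thesis using assms(1) by (simp add: distinct_card)
qed

context group
begin

abbreviation list_prod :: "'a list \<Rightarrow> 'a" where
  "list_prod xs \<equiv> foldr (\<otimes>) xs \<one>"

lemma list_prod_closed [simp]: "set xs \<subseteq> carrier G \<Longrightarrow> list_prod xs \<in> carrier G"
  by (induction xs) auto

lemma list_prod_append:
  "set xs \<subseteq> carrier G \<Longrightarrow> set ys \<subseteq> carrier G \<Longrightarrow>
     list_prod (xs @ ys) = list_prod xs \<otimes> list_prod ys"
  by (induction xs) (auto simp: m_assoc)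

lemma list_prod_alternating_even:
  "a \<in> carrier G \<Longrightarrow> b \<in> carrier G \<Longrightarrow> list_prod (alternating a b (2 * k)) = (a \<otimes> b) [^] k"
proof (induction k)
  case (Suc k)
  have "list_prod (alternating a b (2 * Suc k)) = (a \<otimes> b) \<otimes> list_prod (alternating a b (2 * k))"
    using Suc.prems set_alternating[of a b "2 * k"] by (subst m_assoc) auto
  also have "\<dots> = (a \<otimes> b) [^] Suc k"
    using Suc by (metis m_closed nat_pow_Suc2)
  finally show ?case .
qed simp

definition conjugate :: "'a \<Rightarrow> 'a \<Rightarrow> 'a" where
  "conjugate g t = g \<otimes> t \<otimes> inv g"

lemma conjugate_closed [simp]:
  "g \<in> carrier G \<Longrightarrow> t \<in> carrier G \<Longrightarrow> conjugate g t \<in> carrier G"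
  by (simp add: conjugate_def)

lemma conjugate_mult:
  "g \<in> carrier G \<Longrightarrow> h \<in> carrier G \<Longrightarrow> t \<in> carrier G \<Longrightarrow>
     conjugate (g \<otimes> h) t = conjugate g (conjugate h t)"
  by (simp add: conjugate_def m_assoc inv_mult_group)

lemma conjugate_one: "t \<in> carrier G \<Longrightarrow> conjugate \<one> t = t"
  by (simp add: conjugate_def)

text \<open>For \<open>s\<^sub>1 \<dots> s\<^sub>k\<close> these are the elements
  \<open>s\<^sub>1 \<dots> s\<^sub>i\<^sub>-\<^sub>1 s\<^sub>i (s\<^sub>1 \<dots> s\<^sub>i\<^sub>-\<^sub>1)\<^sup>-\<^sup>1\<close>. How often a reflection occurs in this list is, modulo
  2, an invariant of the product of the word; the parity detects reduced words.\<close>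

fun reflections :: "'a list \<Rightarrow> 'a list" where
  "reflections [] = []"
| "reflections (s # xs) = s # map (conjugate s) (reflections xs)"

lemma length_reflections [simp]: "length (reflections xs) = length xs"
  by (induction xs) auto

lemma set_reflections: "set xs \<subseteq> carrier G \<Longrightarrow> set (reflections xs) \<subseteq> carrier G"
  by (induction xs) auto

lemma reflections_append:
  "set xs \<subseteq> carrier G \<Longrightarrow> set ys \<subseteq> carrier G \<Longrightarrow>
     reflections (xs @ ys) = reflections xs @ map (conjugate (list_prod xs)) (reflections ys)"
proof (induction xs)
  case Nil
  then show ?case
    using set_reflections[of ys] by (auto intro!: map_idI[symmetric] simp: conjugate_one subset_iff)
next
  case (Cons s xs)
  then show ?case
    using set_reflections[of ys] by (auto simp: conjugate_mult subset_iff)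
qed

lemma involution_inv: "a \<in> carrier G \<Longrightarrow> a \<otimes> a = \<one> \<Longrightarrow> inv a = a"
  using inv_equality by blast

lemma mult_pow_swap:
  assumes "a \<in> carrier G" "b \<in> carrier G"
  shows "a \<otimes> (b \<otimes> a) [^] (i::nat) = (a \<otimes> b) [^] i \<otimes> a"
proof (induction i)
  case (Suc i)
  have "a \<otimes> (b \<otimes> a) [^] Suc i = (a \<otimes> (b \<otimes> a) [^] i) \<otimes> (b \<otimes> a)"
    using assms by (simp add: m_assoc)
  also have "\<dots> = (a \<otimes> b) [^] Suc i \<otimes> a"
    unfolding Suc using assms by (simp add: m_assoc)
  finally show ?case .
qed (use assms in simp)

lemma reflections_alternating:
  assumes "a \<in> carrier G" "b \<in> carrier G" "a \<otimes> a = \<one>" "b \<otimes> b = \<one>"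
  shows "reflections (alternating a b k) = map (\<lambda>i. (a \<otimes> b) [^] i \<otimes> a) [0..<k]"
  using assms
proof (induction k arbitrary: a b)
  case (Suc k)
  have inv: "inv a = a"
    using Suc.prems by (simp add: involution_inv)
  have flip: "a \<otimes> (b \<otimes> a) [^] i = (a \<otimes> b) [^] i \<otimes> a" for i :: nat
    using mult_pow_swap Suc.prems by blast
  have conj: "conjugate a ((b \<otimes> a) [^] i \<otimes> b) = (a \<otimes> b) [^] Suc i \<otimes> a" for i :: nat
  proof -
    have "conjugate a ((b \<otimes> a) [^] i \<otimes> b) = (a \<otimes> (b \<otimes> a) [^] i) \<otimes> b \<otimes> a"
      using Suc.prems by (simp add: conjugate_def inv m_assoc)
    also have "\<dots> = (a \<otimes> b) [^] Suc i \<otimes> a"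
      unfolding flip using Suc.prems by (simp add: m_assoc)
    finally show ?thesis .
  qed
  have "reflections (alternating a b (Suc k))
      = a # map (\<lambda>i. conjugate a ((b \<otimes> a) [^] i \<otimes> b)) [0..<k]"
    using Suc.IH[of b a] Suc.prems by simp
  also have "\<dots> = map (\<lambda>i. (a \<otimes> b) [^] i \<otimes> a) (0 # map Suc [0..<k])"
    using Suc.prems by (simp add: conj del: nat_pow_Suc)
  also have "0 # map Suc [0..<k] = [0..<Suc k]"
    by (simp add: map_Suc_upt upt_conv_Cons)
  finally show ?case .
qed simp

lemma list_prod_alternating_swap:
  assumes "a \<in> carrier G" "b \<in> carrier G" "a \<otimes> a = \<one>" "b \<otimes> b = \<one>"
  shows "list_prod (alternating a b k) = (a \<otimes> b) [^] k \<otimes> list_prod (alternating b a k)"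
  using assms
proof (induction k arbitrary: a b)
  case (Suc k)
  have mem: "list_prod (alternating a b k) \<in> carrier G" for k
    using set_alternating[of a b k] Suc.prems by (intro list_prod_closed) auto
  have bb: "b \<otimes> (b \<otimes> z) = z" if "z \<in> carrier G" for z
    using Suc.prems that by (simp flip: m_assoc)
  have flip: "a \<otimes> (b \<otimes> a) [^] i = (a \<otimes> b) [^] i \<otimes> a" for i :: nat
    using mult_pow_swap Suc.prems by blast
  have "list_prod (alternating a b (Suc k)) = a \<otimes> ((b \<otimes> a) [^] k \<otimes> list_prod (alternating a b k))"
    using Suc.IH[of b a] Suc.prems by simp
  also have "\<dots> = (a \<otimes> b) [^] k \<otimes> a \<otimes> (b \<otimes> (b \<otimes> list_prod (alternating a b k)))"
    using Suc.prems mem[of k] by (simp add: bb flip flip: m_assoc)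
  also have "\<dots> = (a \<otimes> b) [^] Suc k \<otimes> list_prod (alternating b a (Suc k))"
    using Suc.prems mem[of k] by (simp add: m_assoc)
  finally show ?case .
qed simp

end

context coxeter_system
begin

lemma generators_closed: "s \<in> S \<Longrightarrow> s \<in> carrier W"
  using presentation by (auto simp: has_presentation_def)

lemma words_closed: "set xs \<subseteq> S \<Longrightarrow> set xs \<subseteq> carrier W"
  using generators_closed by auto

lemma relator_in_words:
  "r \<in> S \<Longrightarrow> s \<in> S \<Longrightarrow> concat (replicate k [(r, True), (s, True)]) \<in> words S"
  by (auto simp: words_def in_lists_conv_set split: if_splits)

lemma word_value_relator:
  assumes "r \<in> S" "s \<in> S"
  shows "word_value W (concat (replicate k [(r, True), (s, True)])) = (r \<otimes> s) [^] k"
proof (induction k)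
  case (Suc k)
  have "word_value W (concat (replicate (Suc k) [(r, True), (s, True)])) =
      r \<otimes> (s \<otimes> (r \<otimes> s) [^] k)"
    using Suc by (simp add: word_value_def)
  also have "\<dots> = (r \<otimes> s) [^] Suc k"
    using assms generators_closed by (metis m_assoc m_closed nat_pow_Suc2 nat_pow_closed)
  finally show ?case .
qed (simp add: word_value_def)

lemma relator_pow:
  assumes "r \<in> S" "s \<in> S" "n r s = enat k"
  shows "(r \<otimes> s) [^] k = \<one>"
proof -
  let ?w = "concat (replicate k [(r, True), (s, True)])"
  have "?w \<in> coxeter_relators S n"
    using assms by (auto simp: coxeter_relators_def)
  then have "presented_eq S (coxeter_relators S n) ([] @ ?w @ []) ([] @ [])"
    using relator_in_words assms by (intro presented_eq.relator) (auto simp: words_def)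
  then have "presented_eq S (coxeter_relators S n) ?w []"
    by simp
  moreover have "[] \<in> words S"
    by (simp add: words_def)
  ultimately have "word_value W ?w = word_value W []"
    using presentation relator_in_words[OF assms(1,2)] unfolding has_presentation_def by blast
  then show ?thesis
    using assms word_value_relator by (simp add: word_value_def)
qed

lemma involution: "s \<in> S \<Longrightarrow> s \<otimes> s = \<one>"
  using relator_pow[of s s 1] n_diag[of s] generators_closed[of s]
  by (simp add: one_enat_def)

lemma inv_generator: "s \<in> S \<Longrightarrow> inv s = s"
  using involution involution_inv generators_closed by blast

lemma word_value_list_prod: "v \<in> words S \<Longrightarrow> word_value W v = list_prod (map fst v)"
  by (induction v) (auto simp: word_value_def words_def inv_generator)

lemma words_map_fst: "v \<in> words S \<Longrightarrow> set (map fst v) \<subseteq> S"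
  by (auto simp: words_def)

lemma generated: "w \<in> carrier W \<Longrightarrow> \<exists>xs. set xs \<subseteq> S \<and> list_prod xs = w"
proof -
  assume "w \<in> carrier W"
  then have "w \<in> word_value W ` words S"
    using presentation by (simp add: has_presentation_def)
  then obtain v where "v \<in> words S" "w = word_value W v"
    by blast
  then show ?thesis
    using word_value_list_prod words_map_fst by metis
qed

lemma presented_eq_if_list_prod_eq:
  assumes "set xs \<subseteq> S" "set ys \<subseteq> S" "list_prod xs = list_prod ys"
  shows "presented_eq S (coxeter_relators S n)
           (map (\<lambda>x. (x, True)) xs) (map (\<lambda>x. (x, True)) ys)"
proof -
  have words: "map (\<lambda>x. (x, True)) zs \<in> words S" if "set zs \<subseteq> S" for zs
    using that by (auto simp: words_def)
  have "word_value W (map (\<lambda>x. (x, True)) xs) = word_value W (map (\<lambda>x. (x, True)) ys)"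
    using words[OF assms(1)] words[OF assms(2)] assms(3)
    by (simp add: word_value_list_prod comp_def)
  then show ?thesis
    using presentation words[OF assms(1)] words[OF assms(2)]
    unfolding has_presentation_def by blast
qed

text \<open>Both parity arguments below treat a relator as an alternating word of even length.\<close>

lemma relator_alternating:
  assumes "z \<in> coxeter_relators S n"
  obtains r s k where "r \<in> S" "s \<in> S" "n r s = enat k" "map fst z = alternating r s (2 * k)"
    "(r \<otimes> s) [^] k = \<one>"
proof -
  obtain r s k where *: "r \<in> S" "s \<in> S" "n r s = enat k"
    "z = concat (replicate k [(r, True), (s, True)])"
    using assms by (auto simp: coxeter_relators_def)
  then have "(r \<otimes> s) [^] k = \<one>"
    using relator_pow by blast
  moreover have "map fst z = alternating r s (2 * k)"
    by (simp add: *(4) map_concat flip: concat_replicate_alternating)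
  ultimately show ?thesis using * that by blast
qed

lemma even_length_if_presented_eq:
  "presented_eq S (coxeter_relators S n) v w \<Longrightarrow> even (length v) \<longleftrightarrow> even (length w)"
proof (induction rule: presented_eq.induct)
  case (relator v w z)
  then obtain r s k where "map fst z = alternating r s (2 * k)"
    by (blast elim: relator_alternating)
  then have "length (map fst z) = 2 * k"
    by simp
  then show ?case by simp
qed auto

text \<open>Inserting a word of product 1 does not disturb the reflections of the letters after it,
  and a list of the form \<open>ks @ ks\<close> contributes each reflection an even number of times.\<close>

lemma even_count_reflections_insert:
  assumes "set xs \<subseteq> S" "set zs \<subseteq> S" "set ys \<subseteq> S"
    and "list_prod zs = \<one>" "reflections zs = ks @ ks"
  shows "even (count_list (reflections (xs @ zs @ ys)) t) \<longleftrightarrow>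
         even (count_list (reflections (xs @ ys)) t)"
proof -
  have cl: "set xs \<subseteq> carrier W" "set zs \<subseteq> carrier W" "set ys \<subseteq> carrier W"
    using assms words_closed by blast+
  have "list_prod (xs @ zs) = list_prod xs"
    using cl assms(4) by (simp add: list_prod_append)
  then have "reflections ((xs @ zs) @ ys) = reflections xs
      @ map (conjugate (list_prod xs)) (ks @ ks)
      @ map (conjugate (list_prod xs)) (reflections ys)"
    using cl assms(5) by (subst reflections_append) (simp_all add: reflections_append)
  moreover have "reflections (xs @ ys) =
      reflections xs @ map (conjugate (list_prod xs)) (reflections ys)"
    using cl by (simp add: reflections_append)
  ultimately show ?thesis
    by simp blast
qed

lemma even_count_reflections_if_presented_eq:
  "presented_eq S (coxeter_relators S n) v w \<Longrightarrow>
     even (count_list (reflections (map fst v)) t) \<longleftrightarrow>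
     even (count_list (reflections (map fst w)) t)"
proof (induction rule: presented_eq.induct)
  case (cancel v w x b)
  have "reflections [x, x] = [x] @ [x]"
    using cancel(3) by (simp add: conjugate_def generators_closed m_assoc)
  moreover have "list_prod [x, x] = \<one>"
    using cancel(3) by (simp add: involution generators_closed)
  ultimately show ?case
    using even_count_reflections_insert[of "map fst v" "[x, x]" "map fst w" "[x]" t]
      words_map_fst[OF cancel(1)] words_map_fst[OF cancel(2)] cancel(3) by simp
next
  case (relator v w z)
  obtain r s k where rs: "r \<in> S" "s \<in> S" "map fst z = alternating r s (2 * k)"
    and pow: "(r \<otimes> s) [^] k = \<one>"
    using relator(3) by (blast elim: relator_alternating)
  have cl: "r \<in> carrier W" "s \<in> carrier W"
    using rs generators_closed by auto
  let ?ks = "map (\<lambda>i. (r \<otimes> s) [^] i \<otimes> r) [0..<k]"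
  \<comment> \<open>The \<open>2 k\<close> reflections \<open>(r s)\<^sup>i r\<close> of the relator repeat with period \<open>k\<close>.\<close>
  have "reflections (map fst z) = map (\<lambda>i. (r \<otimes> s) [^] i \<otimes> r) [0..<2 * k]"
    unfolding rs(3) using reflections_alternating cl rs involution by simp
  also have "[0..<2 * k] = [0..<k] @ map (\<lambda>i. i + k) [0..<k]"
    by (simp add: map_add_upt mult_2 upt_add_eq_append[of 0 k k])
  also have "map (\<lambda>i. (r \<otimes> s) [^] i \<otimes> r) ([0..<k] @ map (\<lambda>i. i + k) [0..<k]) = ?ks @ ?ks"
    using cl pow by (simp flip: nat_pow_mult)
  finally have "reflections (map fst z) = ?ks @ ?ks" .
  moreover have "list_prod (map fst z) = \<one>"
    unfolding rs(3) using list_prod_alternating_even cl pow by simp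
  ultimately show ?case
    using even_count_reflections_insert[of "map fst v" "map fst z" "map fst w" ?ks t]
      words_map_fst[OF relator(1)] words_map_fst[OF relator(2)] words_map_fst[OF relator(4)]
    by simp
qed auto

abbreviation len :: "'w \<Rightarrow> nat" where
  "len \<equiv> coxeter_length W S"

definition reduced :: "'w list \<Rightarrow> bool" where
  "reduced xs \<longleftrightarrow> set xs \<subseteq> S \<and> len (list_prod xs) = length xs"

lemma len_le: "set xs \<subseteq> S \<Longrightarrow> len (list_prod xs) \<le> length xs"
  unfolding coxeter_length_def by (rule Least_le) (auto simp: lists_eq_set)

lemma obtain_reduced:
  assumes "w \<in> carrier W"
  obtains xs where "reduced xs" "list_prod xs = w"
proof -
  have "\<exists>k. \<exists>xs\<in>lists S. length xs = k \<and> list_prod xs = w"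
    using generated[OF assms] by (auto simp: lists_eq_set)
  then have "\<exists>xs\<in>lists S. length xs = len w \<and> list_prod xs = w"
    unfolding coxeter_length_def by (rule LeastI_ex)
  then obtain xs where "xs \<in> lists S" "length xs = len w" "list_prod xs = w"
    by blast
  then show ?thesis
    using that[of xs] by (simp add: reduced_def lists_eq_set)
qed

lemma reduced_tail:
  assumes "reduced (s # xs)"
  shows "reduced xs"
proof -
  have S: "s \<in> S" "set xs \<subseteq> S" and len: "len (s \<otimes> list_prod xs) = Suc (length xs)"
    using assms by (auto simp: reduced_def)
  obtain ys where ys: "reduced ys" "list_prod ys = list_prod xs"
    using obtain_reduced list_prod_closed words_closed S(2) by metis
  have "len (list_prod (s # ys)) \<le> length (s # ys)"
    using ys(1) S(1) by (intro len_le) (auto simp: reduced_def)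
  then have "length xs \<le> length ys"
    using ys len by simp
  moreover have "length ys = len (list_prod xs)"
    using ys by (simp add: reduced_def)
  ultimately show ?thesis
    using len_le[OF S(2)] S by (simp add: reduced_def)
qed

text \<open>All relators have even length, so the parity of the length is well defined on the
  group and multiplication by a generator changes it.\<close>

lemma len_generator_mult_neq:
  assumes "s \<in> S" "w \<in> carrier W"
  shows "len (s \<otimes> w) \<noteq> len w"
proof -
  obtain xs where xs: "reduced xs" "list_prod xs = w"
    using obtain_reduced assms(2) .
  obtain ys where ys: "reduced ys" "list_prod ys = s \<otimes> w"
    using obtain_reduced assms generators_closed m_closed by metis
  have "even (length (map (\<lambda>x. (x, True)) (s # xs))) \<longleftrightarrow>
        even (length (map (\<lambda>x. (x, True)) ys))"
    using presented_eq_if_list_prod_eq[of "s # xs" ys] xs ys assms(1)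
    by (intro even_length_if_presented_eq) (simp add: reduced_def)
  then show ?thesis
    using xs ys by (auto simp: reduced_def)
qed

text \<open>The reflections \<open>(r s)\<^sup>i r\<close> with \<open>i\<close> below the order of \<open>r s\<close> are distinct. Each occurs
  once in the list of the alternating word, hence an odd number of times, in particular at
  least once, in the list of any other word for the same element.\<close>

lemma reduced_alternating:
  assumes "r \<in> S" "s \<in> S" "k \<le> ord (r \<otimes> s)"
  shows "reduced (alternating r s k)"
proof -
  have cl: "r \<in> carrier W" "s \<in> carrier W"
    using assms generators_closed by auto
  have S: "set (alternating r s k) \<subseteq> S"
    using set_alternating[of r s k] assms by auto
  obtain ys where ys: "reduced ys" "list_prod ys = list_prod (alternating r s k)"
    using obtain_reduced list_prod_closed words_closed S by metis
  have "inj_on (\<lambda>i. (r \<otimes> s) [^] i \<otimes> r) {0..<k}"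
  proof (rule inj_onI)
    fix i j
    assume ij: "i \<in> {0..<k}" "j \<in> {0..<k}" "(r \<otimes> s) [^] i \<otimes> r = (r \<otimes> s) [^] j \<otimes> r"
    then have "(r \<otimes> s) [^] i = (r \<otimes> s) [^] j"
      using cl by simp
    moreover have "i \<le> ord (r \<otimes> s) - 1" "j \<le> ord (r \<otimes> s) - 1"
      using ij assms(3) by auto
    ultimately show "i = j"
      using ord_inj[of "r \<otimes> s"] cl by (auto dest: inj_onD)
  qed
  then have "distinct (reflections (alternating r s k))"
    using reflections_alternating cl involution assms by (simp add: distinct_map)
  moreover have "even (count_list (reflections (alternating r s k)) t) \<longleftrightarrow>
      even (count_list (reflections ys) t)" for t
    using even_count_reflections_if_presented_eq[OF
        presented_eq_if_list_prod_eq[OF S _ ys(2)[symmetric]]] ys(1)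
    by (simp add: reduced_def comp_def)
  ultimately have "length (reflections (alternating r s k)) \<le> length (reflections ys)"
    by (rule length_le_if_count_list_parity)
  moreover have "length ys = len (list_prod (alternating r s k))"
    using ys by (simp add: reduced_def)
  ultimately show ?thesis
    using len_le[OF S] S by (simp add: reduced_def)
qed

lemma ord_pos:
  assumes "r \<in> S" "s \<in> S" "n r s < \<infinity>" "r \<noteq> s"
  shows "0 < ord (r \<otimes> s)"
proof -
  obtain k where k: "n r s = enat k"
    using assms(3) by (cases "n r s") auto
  have "0 < k"
    using n_offdiag[OF assms(1,2,4)] k by (cases k) (auto simp: zero_enat_def[symmetric])
  moreover have "(r \<otimes> s) [^] k = \<one>"
    using relator_pow assms k by blast
  ultimately show ?thesis
    using assms generators_closed by (metis m_closed ord_ge_1 ord_eq_0 gr0I)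
qed

lemma list_prod_alternating_ord:
  assumes "r \<in> S" "s \<in> S"
  shows "list_prod (alternating r s (ord (r \<otimes> s))) = list_prod (alternating s r (ord (r \<otimes> s)))"
proof -
  have cl: "r \<in> carrier W" "s \<in> carrier W"
    using assms generators_closed by auto
  then have "list_prod (alternating s r k) \<in> carrier W" for k
    using set_alternating[of s r k] by (intro list_prod_closed) auto
  then show ?thesis
    using list_prod_alternating_swap[OF cl] assms cl by (simp add: involution pow_ord_eq_1)
qed

end

section \<open>Balanced confluence\<close>

text \<open>Local confluence with the additional demand that both branches take equally many steps
  to meet. Unlike mere local confluence, this passes from one terminating reduction to all
  reductions.\<close>

definition balanced :: "('a \<Rightarrow> 'a \<Rightarrow> bool) \<Rightarrow> bool" where
  "balanced R \<longleftrightarrow>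
     (\<forall>x y y'. R x y \<longrightarrow> R x y' \<longrightarrow> (\<exists>z i. (R ^^ i) y z \<and> (R ^^ i) y' z))"

text \<open>Induction on \<open>k\<close>. Let the given reduction of \<open>x\<close> begin with \<open>x'\<close>, and let \<open>w\<close> be the
  common reduct of \<open>x'\<close> and \<open>y\<close> after \<open>i\<close> steps. Applying the induction hypothesis to each of the
  \<open>i\<close> steps from \<open>x'\<close> to \<open>w\<close> shows that \<open>w\<close> is \<open>i\<close> steps closer to \<open>z\<close> than \<open>x'\<close>; as \<open>y\<close> is also
  \<open>i\<close> steps away from \<open>w\<close>, it is as far from \<open>z\<close> as \<open>x'\<close>.\<close>

lemma balanced_normal_form_step:
  assumes balanced: "balanced R"
    and normal: "\<forall>y. \<not> R z y"
  shows "(R ^^ k) x z \<Longrightarrow> R x y \<Longrightarrow> \<exists>j. k = Suc j \<and> (R ^^ j) y z"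
proof (induction k arbitrary: x y rule: less_induct)
  case (less k)
  have "k \<noteq> 0"
    using less.prems normal by (auto intro: ccontr)
  then obtain j where k: "k = Suc j"
    by (cases k) auto
  then obtain x' where x': "R x x'" "(R ^^ j) x' z"
    using less.prems(1) by (blast dest: relpowp_Suc_D2)
  obtain w i where w: "(R ^^ i) x' w" "(R ^^ i) y w"
    using balanced x'(1) less.prems(2) unfolding balanced_def by blast
  \<comment> \<open>The induction hypothesis, iterated along \<open>i\<close> steps.\<close>
  have "\<exists>l. h = i + l \<and> (R ^^ l) w z" if "h < k" "(R ^^ h) x' z" "(R ^^ i) x' w" for h i x'
    using that
  proof (induction i arbitrary: h x')
    case (Suc i)
    obtain x'' where x'': "R x' x''" "(R ^^ i) x'' w"
      using Suc.prems(3) by (blast dest: relpowp_Suc_D2)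
    obtain h' where "h = Suc h'" "(R ^^ h') x'' z"
      using less.IH Suc.prems(1,2) x''(1) by blast
    then show ?case
      using Suc.IH[of h' x''] Suc.prems(1) x''(2) by auto
  qed auto
  then obtain l where "j = i + l" "(R ^^ l) w z"
    using x'(2) w(1) k by blast
  then have "(R ^^ j) y z"
    using w(2) by (auto simp: relpowp_add)
  then show ?case
    using k by blast
qed

lemma balanced_component_reaches_normal_form:
  assumes "balanced R"
    and "\<forall>y. \<not> R z y"
    and "(\<lambda>x y. R x y \<or> R y x)\<^sup>*\<^sup>* z x"
  shows "\<exists>k. (R ^^ k) x z"
  using assms(3)
proof (induction rule: rtranclp_induct)
  case base
  have "(R ^^ 0) z z" by simp
  then show ?case by blast
next
  case (step x y)
  then obtain k where k: "(R ^^ k) x z"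
    by blast
  from step.hyps(2) show ?case
  proof
    assume "R x y"
    then show ?thesis
      using balanced_normal_form_step[OF assms(1,2) k \<open>R x y\<close>] by auto
  next
    assume "R y x"
    then show ?thesis
      using k by (intro exI[of _ "Suc k"]) (rule relpowp_Suc_I2)
  qed
qed

lemma balanced_component_unique_normal_form:
  assumes "balanced R"
    and "\<forall>y. \<not> R z y" and "\<forall>y. \<not> R x y"
    and "(\<lambda>x y. R x y \<or> R y x)\<^sup>*\<^sup>* z x"
  shows "x = z"
proof -
  obtain k where "(R ^^ k) x z"
    using balanced_component_reaches_normal_form[OF assms(1,2,4)] by blast
  then show ?thesis
    using assms(3) by (cases k) (auto dest!: relpowp_Suc_D2 simp del: relpowp.simps(2))
qed

text \<open>The number of steps from \<open>x\<close> to \<open>z\<close> drops along every step, so running once around a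
  circuit would produce shorter and shorter reductions of \<open>x\<close>.\<close>

lemma balanced_component_acyclic:
  assumes "balanced R"
    and "\<forall>y. \<not> R z y"
    and "(\<lambda>x y. R x y \<or> R y x)\<^sup>*\<^sup>* z x"
  shows "\<not> R\<^sup>+\<^sup>+ x x"
proof
  assume "R\<^sup>+\<^sup>+ x x"
  then obtain i where i: "0 < i" "(R ^^ i) x x"
    by (auto simp: tranclp_power)
  have descend: "\<exists>l. h = i + l \<and> (R ^^ l) y z" if "(R ^^ h) x z" "(R ^^ i) x y" for h i x y
    using that
  proof (induction i arbitrary: h x)
    case (Suc i)
    obtain x' where x': "R x x'" "(R ^^ i) x' y"
      using Suc.prems(2) by (blast dest: relpowp_Suc_D2)
    obtain h' where "h = Suc h'" "(R ^^ h') x' z"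
      using balanced_normal_form_step[OF assms(1,2) Suc.prems(1) x'(1)] by blast
    then show ?case
      using Suc.IH[of h' x'] x'(2) by auto
  qed auto
  have "\<not> (R ^^ h) x z" for h
  proof (induction h rule: less_induct)
    case (less h)
    show ?case
    proof
      assume "(R ^^ h) x z"
      then obtain l where "h = i + l" "(R ^^ l) x z"
        using descend i(2) by blast
      then show False
        using less i(1) by auto
    qed
  qed
  then show False
    using balanced_component_reaches_normal_form[OF assms] by blast
qed

lemma relpowp_conversep:
  fixes R :: "'a \<Rightarrow> 'a \<Rightarrow> bool"
  shows "(R\<inverse>\<inverse> ^^ i) y x \<longleftrightarrow> (R ^^ i) x y"
proof (induction i arbitrary: x)
  case (Suc i)
  have "(R\<inverse>\<inverse> ^^ Suc i) y x \<longleftrightarrow> (\<exists>z. (R ^^ i) z y \<and> R x z)"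
    by (simp only: relpowp.simps OO_def Suc conversep_iff)
  also have "\<dots> \<longleftrightarrow> (R ^^ Suc i) x y"
    using relpowp_Suc_I2[of R x _ i y] relpowp_Suc_D2[of i R x y] by blast
  finally show ?case .
qed auto

section \<open>Operators on vertex functions with a variable parameter\<close>

definition delta :: "'v \<Rightarrow> 'v \<Rightarrow> 'a::zero_neq_one" where
  "delta \<alpha> \<beta> = (if \<beta> = \<alpha> then 1 else 0)"

text \<open>A labeled digraph in which every vertex is on exactly one edge of each label, seen from
  its vertices: \<open>nbr s \<alpha>\<close> is the other end of the edge labeled \<open>s\<close> at \<open>\<alpha>\<close>, \<open>out s \<alpha>\<close> says that
  this edge starts at \<open>\<alpha>\<close>, and \<open>dsh s \<alpha>\<close> that it is dashed.\<close>

locale matching_digraph =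
  fixes V :: "'v set" and S :: "'s set" and nbr :: "'s \<Rightarrow> 'v \<Rightarrow> 'v"
    and out :: "'s \<Rightarrow> 'v \<Rightarrow> bool" and dsh :: "'s \<Rightarrow> 'v \<Rightarrow> bool"
  assumes nbr_closed: "s \<in> S \<Longrightarrow> \<alpha> \<in> V \<Longrightarrow> nbr s \<alpha> \<in> V"
    and nbr_nbr: "s \<in> S \<Longrightarrow> \<alpha> \<in> V \<Longrightarrow> nbr s (nbr s \<alpha>) = \<alpha>"
    and out_nbr: "s \<in> S \<Longrightarrow> \<alpha> \<in> V \<Longrightarrow> out s (nbr s \<alpha>) \<longleftrightarrow> \<not> out s \<alpha>"
    and dsh_nbr: "s \<in> S \<Longrightarrow> \<alpha> \<in> V \<Longrightarrow> dsh s (nbr s \<alpha>) \<longleftrightarrow> dsh s \<alpha>"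
begin

definition diag :: "'a::comm_ring_1 \<Rightarrow> 's \<Rightarrow> 'v \<Rightarrow> 'a" where
  "diag q s \<alpha> =
     (if out s \<alpha> then if dsh s \<alpha> then q else 0
      else if dsh s \<alpha> then q^2 - q - 1 else q^2 - 1)"

definition off :: "'a::comm_ring_1 \<Rightarrow> 's \<Rightarrow> 'v \<Rightarrow> 'a" where
  "off q s \<alpha> =
     (if out s \<alpha> then if dsh s \<alpha> then q + 1 else 1
      else if dsh s \<alpha> then q^2 - q else q^2)"

text \<open>The operator \<open>\<tau>\<^sub>s\<close> in coordinates, with \<open>u\<close> replaced by an element \<open>q\<close> of any commutative
  ring: \<open>x\<close> is the family of coefficients of a vector, and \<open>diag q s \<alpha>\<close> and \<open>off q s \<alpha>\<close> are the
  coefficients of \<open>\<tau>\<^sub>s \<alpha>\<close> at \<open>\<alpha>\<close> and at its neighbour. A ring homomorphism \<open>h\<close> acts on coefficient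
  functions by composition and carries \<open>act q\<close> to \<open>act (h q)\<close>.\<close>

definition act :: "'a::comm_ring_1 \<Rightarrow> 's \<Rightarrow> ('v \<Rightarrow> 'a) \<Rightarrow> 'v \<Rightarrow> 'a" where
  "act q s x \<alpha> =
     (if \<alpha> \<in> V then diag q s \<alpha> * x \<alpha> + off q s (nbr s \<alpha>) * x (nbr s \<alpha>) else 0)"

lemma act_delta:
  assumes "s \<in> S" "\<alpha> \<in> V"
  shows "act q s (delta \<alpha>) =
    (\<lambda>\<beta>. diag q s \<alpha> * delta \<alpha> \<beta> + off q s \<alpha> * delta (nbr s \<alpha>) \<beta>)"
proof
  fix \<beta>
  have "nbr s \<beta> = \<alpha> \<longleftrightarrow> \<beta> = nbr s \<alpha>" if "\<beta> \<in> V"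
    using assms that nbr_nbr by metis
  then show "act q s (delta \<alpha>) \<beta> =
      diag q s \<alpha> * delta \<alpha> \<beta> + off q s \<alpha> * delta (nbr s \<alpha>) \<beta>"
    using assms nbr_closed[OF assms] by (auto simp: act_def delta_def)
qed

lemma act_linear:
  "act q s (\<lambda>\<beta>. c * x \<beta> + d * y \<beta>) = (\<lambda>\<beta>. c * act q s x \<beta> + d * act q s y \<beta>)"
  by (rule ext) (simp add: act_def algebra_simps)

lemma fold_act_linear:
  "fold (act q) ss (\<lambda>\<beta>. c * x \<beta> + d * y \<beta>) =
     (\<lambda>\<beta>. c * fold (act q) ss x \<beta> + d * fold (act q) ss y \<beta>)"
  by (induction ss arbitrary: x y) (simp_all add: act_linear)

lemma fold_act_scale:
  "fold (act q) ss (\<lambda>\<beta>. c * x \<beta>) = (\<lambda>\<beta>. c * fold (act q) ss x \<beta>)"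
  using fold_act_linear[of q ss c x 0 x] by simp

lemma fold_act_add:
  "fold (act q) ss (\<lambda>\<beta>. x \<beta> + y \<beta>) = (\<lambda>\<beta>. fold (act q) ss x \<beta> + fold (act q) ss y \<beta>)"
  using fold_act_linear[of q ss 1 x 1 y] by simp

lemma act_quadratic:
  assumes "s \<in> S" "\<And>\<beta>. \<beta> \<notin> V \<Longrightarrow> x \<beta> = 0"
  shows "act q s (act q s x) = (\<lambda>\<beta>. q^2 * x \<beta> + (q^2 - 1) * act q s x \<beta>)"
proof
  fix \<beta>
  show "act q s (act q s x) \<beta> = q^2 * x \<beta> + (q^2 - 1) * act q s x \<beta>"
  proof (cases "\<beta> \<in> V")
    case True
    then show ?thesis
      using assms(1) nbr_closed nbr_nbr out_nbr dsh_nbr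
      by (simp add: act_def diag_def off_def power2_eq_square) (simp add: algebra_simps)
  qed (use assms(2) in \<open>simp add: act_def\<close>)
qed

text \<open>A path is given by its starting vertex and the labels of its edges, first edge first,
  so it ends at \<open>fold nbr ss \<alpha>\<close>. Products in the group and in the algebra act from the
  right end of a word; passing between the two conventions reverses the list.\<close>

fun ascending :: "'s list \<Rightarrow> 'v \<Rightarrow> bool" where
  "ascending [] \<alpha> \<longleftrightarrow> True"
| "ascending (s # ss) \<alpha> \<longleftrightarrow> out s \<alpha> \<and> ascending ss (nbr s \<alpha>)"

lemma ascending_append:
  "ascending (ss @ ts) \<alpha> \<longleftrightarrow> ascending ss \<alpha> \<and> ascending ts (fold nbr ss \<alpha>)"
  by (induction ss arbitrary: \<alpha>) auto

lemma fold_nbr_closed: "set ss \<subseteq> S \<Longrightarrow> \<alpha> \<in> V \<Longrightarrow> fold nbr ss \<alpha> \<in> V"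
  by (induction ss arbitrary: \<alpha>) (auto simp: nbr_closed)

definition step :: "'v \<Rightarrow> 'v \<Rightarrow> bool" where
  "step \<alpha> \<beta> \<longleftrightarrow> \<alpha> \<in> V \<and> (\<exists>s\<in>S. out s \<alpha> \<and> \<beta> = nbr s \<alpha>)"

lemma step_relpowp_if_ascending:
  "ascending ss \<alpha> \<Longrightarrow> set ss \<subseteq> S \<Longrightarrow> \<alpha> \<in> V \<Longrightarrow> (step ^^ length ss) \<alpha> (fold nbr ss \<alpha>)"
proof (induction ss arbitrary: \<alpha>)
  case (Cons s ss)
  then have "step \<alpha> (nbr s \<alpha>)"
    by (auto simp: step_def)
  moreover have "(step ^^ length ss) (nbr s \<alpha>) (fold nbr ss (nbr s \<alpha>))"
    using Cons by (simp add: nbr_closed)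
  ultimately show ?case
    by (simp add: relpowp_Suc_I2 del: relpowp.simps)
qed simp

section \<open>Ascending paths and the parameter 0\<close>

lemma act_zero_out:
  "s \<in> S \<Longrightarrow> \<alpha> \<in> V \<Longrightarrow> out s \<alpha> \<Longrightarrow> act (0::rat) s (delta \<alpha>) = delta (nbr s \<alpha>)"
  by (simp add: act_delta) (simp add: diag_def off_def)

lemma act_zero_in:
  "s \<in> S \<Longrightarrow> \<alpha> \<in> V \<Longrightarrow> \<not> out s \<alpha> \<Longrightarrow> act (0::rat) s (delta \<alpha>) = (\<lambda>\<beta>. - 1 * delta \<alpha> \<beta>)"
  by (simp add: act_delta) (simp add: diag_def off_def)

lemma fold_act_zero_ascending:
  "ascending ss \<alpha> \<Longrightarrow> set ss \<subseteq> S \<Longrightarrow> \<alpha> \<in> V \<Longrightarrow>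
     fold (act (0::rat)) ss (delta \<alpha>) = delta (fold nbr ss \<alpha>)"
  by (induction ss arbitrary: \<alpha>) (simp_all add: act_zero_out nbr_closed)

lemma alternating_subset: "a \<in> S \<Longrightarrow> b \<in> S \<Longrightarrow> set (alternating a b k) \<subseteq> S"
  using set_alternating[of a b k] by auto

lemma ascending_alternating_out:
  assumes "ascending (alternating a b j) \<alpha>" "i < j"
  shows "out (if even i then a else b) (fold nbr (alternating a b i) \<alpha>)"
  using assms
proof (induction j)
  case (Suc j)
  then show ?case
    unfolding alternating_snoc by (auto simp: ascending_append less_Suc_eq)
qed simp

lemma not_out_after_alternating:
  assumes "a \<in> S" "b \<in> S" "\<alpha> \<in> V" "ascending (alternating a b (Suc k)) \<alpha>"
  shows "\<not> out (if even k then a else b) (fold nbr (alternating a b (Suc k)) \<alpha>)"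
proof -
  let ?\<beta> = "fold nbr (alternating a b k) \<alpha>"
  have "?\<beta> \<in> V"
    using fold_nbr_closed alternating_subset assms by blast
  moreover have "out (if even k then a else b) ?\<beta>"
    using ascending_alternating_out assms(4) by blast
  ultimately show ?thesis
    unfolding alternating_snoc using assms(1,2) by (simp add: out_nbr)
qed

text \<open>At \<open>q = 0\<close> the alternating word moves \<open>\<alpha>\<close> along its alternating path until the next edge
  points the wrong way. The path arrived through the edge with the other label, so both edges
  now come in, and all remaining letters only change the sign.\<close>

lemma fold_act_zero_alternating:
  assumes "a \<in> S" "b \<in> S" "\<alpha> \<in> V" "out a \<alpha>"
  shows "\<exists>j\<le>m. ascending (alternating a b j) \<alpha> \<and>
    (\<exists>c. c \<noteq> 0 \<and> fold (act (0::rat)) (alternating a b m) (delta \<alpha>) =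
       (\<lambda>\<beta>. c * delta (fold nbr (alternating a b j) \<alpha>) \<beta>)) \<and>
    (j = m \<or> \<not> out a (fold nbr (alternating a b j) \<alpha>) \<and>
              \<not> out b (fold nbr (alternating a b j) \<alpha>))"
proof (induction m)
  case 0
  show ?case
    by (intro exI[of _ "0::nat"] conjI exI[of _ "1::rat"]) auto
next
  case (Suc m)
  then obtain j c where j: "j \<le> m" "ascending (alternating a b j) \<alpha>" "c \<noteq> 0"
    and eq: "fold (act (0::rat)) (alternating a b m) (delta \<alpha>) =
       (\<lambda>\<beta>. c * delta (fold nbr (alternating a b j) \<alpha>) \<beta>)"
    and stop: "j = m \<or> \<not> out a (fold nbr (alternating a b j) \<alpha>) \<and>
              \<not> out b (fold nbr (alternating a b j) \<alpha>)"
    by blast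
  let ?e = "fold nbr (alternating a b j) \<alpha>" and ?t = "if even m then a else b"
  have t: "?t \<in> S" and e: "?e \<in> V"
    using assms fold_nbr_closed[OF alternating_subset] by auto
  have "fold (act (0::rat)) (alternating a b (Suc m)) (delta \<alpha>) =
      act 0 ?t (fold (act 0) (alternating a b m) (delta \<alpha>))"
    unfolding alternating_snoc by simp
  also have "\<dots> = (\<lambda>\<beta>. c * act 0 ?t (delta ?e) \<beta>)"
    unfolding eq using fold_act_scale[of 0 "[?t]" c "delta ?e"] by simp
  finally have next_eq: "fold (act (0::rat)) (alternating a b (Suc m)) (delta \<alpha>) =
      (\<lambda>\<beta>. c * act 0 ?t (delta ?e) \<beta>)" .
  show ?case
  proof (cases "out ?t ?e")
    case True
    then have "j = m"
      using stop by (auto split: if_splits)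
    moreover have "fold nbr (alternating a b (Suc m)) \<alpha> = nbr ?t (fold nbr (alternating a b m) \<alpha>)"
      unfolding alternating_snoc by simp
    moreover have "ascending (alternating a b (Suc m)) \<alpha>"
      using j(2) True \<open>j = m\<close> unfolding alternating_snoc by (simp add: ascending_append)
    ultimately show ?thesis
      using next_eq act_zero_out[OF t e True] j(3)
      by (intro exI[of _ "Suc m"]) (auto simp del: alternating.simps)
  next
    case False
    have "\<not> out a ?e \<and> \<not> out b ?e"
    proof (cases "j = m")
      case True
      show ?thesis
      proof (cases j)
        case 0
        then show ?thesis using False True assms(4) by simp
      next
        case (Suc k)
        then show ?thesis
          using not_out_after_alternating[OF assms(1-3), of k] j(2) False True
          by (auto split: if_splits simp del: alternating.simps)
      qed
    qed (use stop in blast)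
    moreover have "fold (act (0::rat)) (alternating a b (Suc m)) (delta \<alpha>) =
        (\<lambda>\<beta>. (- c) * delta ?e \<beta>)"
      unfolding next_eq act_zero_in[OF t e False] by simp
    ultimately show ?thesis
      using j by (intro exI[of _ j] conjI exI[of _ "- c"]) (auto simp del: alternating.simps)
  qed
qed

section \<open>Equal path lengths from the parameter 2\<close>

text \<open>The sum of \<open>T\<^sub>w\<close> over the dihedral group generated by \<open>a\<close> and \<open>b\<close>, at \<open>u = 2\<close>. Every
  \<open>w\<close> other than the longest element is a unique alternating word, and the words
  are grouped into pairs \<open>w, w a\<close>, so that \<open>1 + T\<^sub>a\<close> is a right factor. Exchanging \<open>a\<close> and
  \<open>b\<close> gives the same sum because of the braid relation, so \<open>1 + T\<^sub>b\<close> is a right factor too.\<close>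

definition dihedral_sum :: "'s \<Rightarrow> 's \<Rightarrow> nat \<Rightarrow> ('v \<Rightarrow> rat) \<Rightarrow> 'v \<Rightarrow> rat" where
  "dihedral_sum a b m x \<beta> =
     (\<Sum>k<m. fold (act 2) (alternating b a k) x \<beta> + fold (act 2) (alternating a b (Suc k)) x \<beta>)"

lemma dihedral_sum_linear:
  "dihedral_sum a b m (\<lambda>\<beta>. c * x \<beta> + d * y \<beta>) \<beta> =
     c * dihedral_sum a b m x \<beta> + d * dihedral_sum a b m y \<beta>"
  unfolding dihedral_sum_def
  by (simp add: fold_act_linear sum_distrib_left sum.distrib algebra_simps del: alternating.simps)

lemma dihedral_sum_swap:
  assumes "fold (act 2) (alternating a b m) x = fold (act 2) (alternating b a m) x"
  shows "dihedral_sum a b m x \<beta> = dihedral_sum b a m x \<beta>"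
proof -
  let ?A = "\<lambda>k. fold (act 2) (alternating a b k) x \<beta>"
  let ?B = "\<lambda>k. fold (act 2) (alternating b a k) x \<beta>"
  have "(\<Sum>k<m. ?A (Suc k)) + ?A 0 = (\<Sum>k<m. ?A k) + ?A m"
    using sum.lessThan_Suc_shift[of ?A m] sum.lessThan_Suc[of ?A m] by linarith
  moreover have "(\<Sum>k<m. ?B (Suc k)) + ?B 0 = (\<Sum>k<m. ?B k) + ?B m"
    using sum.lessThan_Suc_shift[of ?B m] sum.lessThan_Suc[of ?B m] by linarith
  moreover have "?A 0 = ?B 0" "?A m = ?B m"
    using assms by simp_all
  moreover have "dihedral_sum a b m x \<beta> = (\<Sum>k<m. ?B k) + (\<Sum>k<m. ?A (Suc k))"
    "dihedral_sum b a m x \<beta> = (\<Sum>k<m. ?A k) + (\<Sum>k<m. ?B (Suc k))"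
    unfolding dihedral_sum_def by (simp_all only: sum.distrib)
  ultimately show ?thesis
    by linarith
qed

text \<open>By the quadratic relation, \<open>(1 + T\<^sub>a) T\<^sub>a = q\<^sup>2 (1 + T\<^sub>a)\<close>.\<close>

lemma dihedral_sum_act:
  assumes "a \<in> S" "\<alpha> \<in> V"
  shows "dihedral_sum a b m (act 2 a (delta \<alpha>)) \<beta> = 4 * dihedral_sum a b m (delta \<alpha>) \<beta>"
proof -
  have factor: "dihedral_sum a b m x \<beta> =
      (\<Sum>k<m. fold (act 2) (alternating b a k) (\<lambda>\<gamma>. x \<gamma> + act 2 a x \<gamma>) \<beta>)" for x
    unfolding dihedral_sum_def by (simp add: fold_act_add)
  have "act 2 a (act 2 a (delta \<alpha>)) = (\<lambda>\<beta>. 2^2 * delta \<alpha> \<beta> + (2^2 - 1) * act (2::rat) a (delta \<alpha>) \<beta>)"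
    using assms by (intro act_quadratic) (auto simp: delta_def)
  then have "(\<lambda>\<gamma>. act 2 a (delta \<alpha>) \<gamma> + act 2 a (act 2 a (delta \<alpha>)) \<gamma>) =
      (\<lambda>\<gamma>. 4 * (delta \<alpha> \<gamma> + act (2::rat) a (delta \<alpha>) \<gamma>))"
    by (simp add: fun_eq_iff)
  then show ?thesis
    unfolding factor by (simp only: fold_act_scale sum_distrib_left)
qed

lemma fold_act_two_nonneg:
  assumes "\<And>\<beta>. 0 \<le> x \<beta>"
  shows "0 \<le> fold (act (2::rat)) ss x \<beta>"
  using assms
proof (induction ss arbitrary: x)
  case (Cons s ss)
  have "0 \<le> act 2 s x \<beta>" for \<beta>
    using Cons.prems by (simp add: act_def diag_def off_def)
  then show ?case
    using Cons.IH by simp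
qed simp

text \<open>For \<open>q = 2\<close> all matrix entries are nonnegative, so the summand of the identity
  element cannot be cancelled.\<close>

lemma dihedral_sum_pos:
  assumes "0 < m"
  shows "0 < dihedral_sum a b m (delta \<alpha>) \<alpha>"
proof -
  let ?f = "\<lambda>k. fold (act 2) (alternating b a k) (delta \<alpha>) \<alpha>
      + fold (act (2::rat)) (alternating a b (Suc k)) (delta \<alpha>) \<alpha>"
  have nonneg: "0 \<le> fold (act (2::rat)) ss (delta \<alpha>) \<beta>" for ss \<beta>
    by (rule fold_act_two_nonneg) (simp add: delta_def)
  have "1 \<le> ?f 0"
    using nonneg[of "[a]" \<alpha>] by (simp add: delta_def)
  also have "?f 0 \<le> (\<Sum>k<m. ?f k)"
    using assms nonneg by (intro member_le_sum) (auto simp del: alternating.simps)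
  finally show ?thesis
    by (simp add: dihedral_sum_def)
qed

lemma two_three_power_unique:
  fixes a b c d :: nat
  assumes "2 ^ a * 3 ^ b = (2 ^ c * 3 ^ d :: nat)"
  shows "a = c" "b = d"
proof -
  have two: "multiplicity (2::nat) (2 ^ a * 3 ^ b) = a" for a b :: nat
  proof -
    have "multiplicity (2::nat) (3 ^ b) = 0"
      by (rule not_dvd_imp_multiplicity_0) simp
    then show ?thesis
      by (simp add: prime_elem_multiplicity_mult_distrib)
  qed
  show "a = c"
    using two[of a b] two[of c d] assms by simp
  then show "b = d"
    using assms by simp
qed

text \<open>Let \<open>f \<beta>\<close> be the coefficient at \<open>\<alpha>\<close> of the dihedral sum applied to \<open>\<beta>\<close>. The value of \<open>f\<close>
  is multiplied by 4 along a solid edge and by 2/3 along a dashed edge. As \<open>f \<alpha>\<close> is positive,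
  unique factorization into powers of 2 and 3 determines from the ends of a path how many
  edges of each kind it has.\<close>

lemma ascending_same_length:
  assumes ab: "a \<in> S" "b \<in> S" and m: "0 < m"
    and braid: "\<And>\<beta>. \<beta> \<in> V \<Longrightarrow> fold (act (2::rat)) (alternating a b m) (delta \<beta>) =
        fold (act 2) (alternating b a m) (delta \<beta>)"
    and \<alpha>: "\<alpha> \<in> V" and ss: "ascending ss \<alpha>" "set ss \<subseteq> {a, b}"
    and ts: "ascending ts \<alpha>" "set ts \<subseteq> {a, b}"
    and meet: "fold nbr ss \<alpha> = fold nbr ts \<alpha>"
  shows "length ss = length ts"
proof -
  define f where "f \<beta> = dihedral_sum a b m (delta \<beta>) \<alpha>" for \<beta>
  have f_eigen: "diag 2 c \<beta> * f \<beta> + off 2 c \<beta> * f (nbr c \<beta>) = 4 * f \<beta>"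
    if "c \<in> {a, b}" "\<beta> \<in> V" for c \<beta>
  proof -
    have c: "c \<in> S"
      using that ab by auto
    have swap: "f \<beta> = dihedral_sum b a m (delta \<beta>) \<alpha>" if "\<beta> \<in> V" for \<beta>
      unfolding f_def using dihedral_sum_swap braid that by blast
    show ?thesis
    proof (cases "c = a")
      case True
      then show ?thesis
        using dihedral_sum_act[OF ab(1) that(2), of b m \<alpha>] act_delta[OF ab(1) that(2), of "2::rat"]
        by (simp add: dihedral_sum_linear f_def)
    next
      case False
      then have "c = b" using that by simp
      then show ?thesis
        using dihedral_sum_act[OF ab(2) that(2), of a m \<alpha>] act_delta[OF ab(2) that(2), of "2::rat"]
          nbr_closed[OF c that(2)] that(2)
        by (simp add: dihedral_sum_linear swap)
    qed
  qed
  \<comment> \<open>Here \<open>p\<close> counts the solid and \<open>r\<close> the dashed edges of the path.\<close>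
  have path: "\<exists>p r. length ss = p + r \<and> 3 ^ r * f (fold nbr ss \<beta>) = 2 ^ (2 * p + r) * f \<beta>"
    if "ascending ss \<beta>" "set ss \<subseteq> {a, b}" "\<beta> \<in> V" for ss \<beta>
    using that
  proof (induction ss arbitrary: \<beta>)
    case Nil
    show ?case by (intro exI[of _ "0::nat"]) simp
  next
    case (Cons c ss)
    let ?\<gamma> = "nbr c \<beta>"
    have "?\<gamma> \<in> V"
      using Cons.prems ab by (auto intro: nbr_closed)
    then obtain p r where pr: "length ss = p + r"
      "3 ^ r * f (fold nbr ss ?\<gamma>) = 2 ^ (2 * p + r) * f ?\<gamma>"
      using Cons.IH[of ?\<gamma>] Cons.prems by auto
    show ?case
    proof (cases "dsh c \<beta>")
      case True
      then have "3 * f ?\<gamma> = 2 * f \<beta>"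
        using f_eigen[of c \<beta>] Cons.prems by (simp add: diag_def off_def)
      then have "3 ^ Suc r * f (fold nbr ss ?\<gamma>) = 2 ^ (2 * p + Suc r) * f \<beta>"
        using pr(2) by (simp add: algebra_simps)
      then show ?thesis
        using pr(1) by (intro exI[of _ p] exI[of _ "Suc r"]) simp
    next
      case False
      then have "f ?\<gamma> = 4 * f \<beta>"
        using f_eigen[of c \<beta>] Cons.prems by (simp add: diag_def off_def)
      then have "3 ^ r * f (fold nbr ss ?\<gamma>) = 2 ^ (2 * Suc p + r) * f \<beta>"
        using pr(2) by (simp add: algebra_simps)
      then show ?thesis
        using pr(1) by (intro exI[of _ "Suc p"] exI[of _ r]) simp
    qed
  qed
  obtain p r where pr: "length ss = p + r"
    "3 ^ r * f (fold nbr ss \<alpha>) = 2 ^ (2 * p + r) * f \<alpha>"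
    using path[OF ss \<alpha>] by blast
  obtain p' r' where pr': "length ts = p' + r'"
    "3 ^ r' * f (fold nbr ss \<alpha>) = 2 ^ (2 * p' + r') * f \<alpha>"
    using path[OF ts \<alpha>] meet by auto
  have "(2 ^ (2 * p + r) * 3 ^ r') * f \<alpha> = 3 ^ r' * (3 ^ r * f (fold nbr ss \<alpha>))"
    unfolding pr(2) by simp
  also have "\<dots> = 3 ^ r * (3 ^ r' * f (fold nbr ss \<alpha>))"
    by simp
  also have "\<dots> = (2 ^ (2 * p' + r') * 3 ^ r) * f \<alpha>"
    unfolding pr'(2) by simp
  finally have "2 ^ (2 * p + r) * 3 ^ r' = (2 ^ (2 * p' + r') * 3 ^ r :: rat)"
    using dihedral_sum_pos[OF m, of a b \<alpha>] by (simp add: f_def)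
  then have "of_nat (2 ^ (2 * p + r) * 3 ^ r') = (of_nat (2 ^ (2 * p' + r') * 3 ^ r) :: rat)"
    by simp
  then have "2 ^ (2 * p + r) * 3 ^ r' = (2 ^ (2 * p' + r') * 3 ^ r :: nat)"
    by (simp only: of_nat_eq_iff)
  from two_three_power_unique[OF this] show ?thesis
    using pr(1) pr'(1) by simp
qed

section \<open>Two labels\<close>

text \<open>At \<open>q = 0\<close> the two sides of the braid relation send \<open>\<alpha>\<close>, up to sign, to the ends of the
  two alternating paths from \<open>\<alpha>\<close>; these ends must agree.\<close>

lemma alternating_meet:
  assumes "a \<in> S" "b \<in> S" "\<alpha> \<in> V" "out a \<alpha>" "out b \<alpha>" and m: "0 < m"
    and braid: "\<forall>q::rat. \<forall>\<alpha>\<in>V.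
      fold (act q) (alternating a b m) (delta \<alpha>) = fold (act q) (alternating b a m) (delta \<alpha>)"
  shows "\<exists>j>0. j \<le> m \<and> ascending (alternating a b j) \<alpha> \<and> ascending (alternating b a j) \<alpha> \<and>
    fold nbr (alternating a b j) \<alpha> = fold nbr (alternating b a j) \<alpha> \<and>
    (j = m \<or> \<not> out a (fold nbr (alternating a b j) \<alpha>) \<and>
              \<not> out b (fold nbr (alternating a b j) \<alpha>))"
proof -
  let ?e = "\<lambda>a b j. fold nbr (alternating a b j) \<alpha>"
  obtain j c where j: "j \<le> m" "ascending (alternating a b j) \<alpha>" "c \<noteq> 0"
    "fold (act (0::rat)) (alternating a b m) (delta \<alpha>) = (\<lambda>\<beta>. c * delta (?e a b j) \<beta>)"
    "j = m \<or> \<not> out a (?e a b j) \<and> \<not> out b (?e a b j)"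
    using fold_act_zero_alternating[OF assms(1,2,3,4), of m] by blast
  obtain k d where k: "ascending (alternating b a k) \<alpha>" "d \<noteq> 0"
    "fold (act (0::rat)) (alternating b a m) (delta \<alpha>) = (\<lambda>\<beta>. d * delta (?e b a k) \<beta>)"
    using fold_act_zero_alternating[OF assms(2,1,3,5), of m] by blast
  have "c * delta (?e a b j) (?e a b j) = d * delta (?e b a k) (?e a b j)"
    using braid assms(3) j(4) k(3) by metis
  then have meet: "?e a b j = ?e b a k"
    using j(3) by (simp add: delta_def split: if_splits)
  have "length (alternating a b j) = length (alternating b a k)"
    using set_alternating[of a b j] set_alternating[of b a k] meet
    by (intro ascending_same_length[OF assms(1,2) m _ assms(3) j(2) _ k(1)])
      (use braid in auto)
  then have "k = j"
    by simp
  moreover have "j \<noteq> 0"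
  proof
    assume "j = 0"
    then show False
      using j(5) m assms(4) by simp
  qed
  ultimately show ?thesis
    using j k meet by auto
qed

text \<open>Walking backwards from \<open>\<gamma>\<close> along alternating edges, starting with the one labeled \<open>a\<close>,
  either reaches a vertex from which both edges go out, or can be continued for \<open>k\<close> steps.
  After \<open>i\<close> steps, \<open>c\<close> is the label of the step taken last and \<open>d\<close> that of the next one.\<close>

lemma descend_alternating:
  assumes "a \<in> S" "b \<in> S" "\<gamma> \<in> V" "\<not> out a \<gamma>"
  shows "\<exists>\<delta>\<in>V. \<exists>i\<le>k. \<exists>c d. (c, d) = (if odd i then (a, b) else (b, a)) \<and>
    ascending (alternating c d i) \<delta> \<and> fold nbr (alternating c d i) \<delta> = \<gamma> \<and>
    (out c \<delta> \<and> out d \<delta> \<or> i = k \<and> \<not> out d \<delta>)"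
proof (induction k)
  case 0
  show ?case
    using assms by (intro bexI[of _ \<gamma>] exI[of _ "0::nat"]) auto
next
  case (Suc k)
  then obtain \<delta> i c d where \<delta>: "\<delta> \<in> V" "i \<le> k" "(c, d) = (if odd i then (a, b) else (b, a))"
    "ascending (alternating c d i) \<delta>" "fold nbr (alternating c d i) \<delta> = \<gamma>"
    and cases: "out c \<delta> \<and> out d \<delta> \<or> i = k \<and> \<not> out d \<delta>"
    by blast
  show ?case
  proof (cases "out c \<delta> \<and> out d \<delta>")
    case True
    then show ?thesis
      using \<delta> le_Suc_eq by blast
  next
    case False
    then have ik: "i = k" and d: "\<not> out d \<delta>"
      using cases by auto
    have dS: "d \<in> S"
      using \<delta>(3) assms(1,2) by (auto split: if_splits)
    let ?\<delta> = "nbr d \<delta>"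
    have "out d ?\<delta>" "nbr d ?\<delta> = \<delta>" "?\<delta> \<in> V"
      using d dS \<delta>(1) by (simp_all add: out_nbr nbr_nbr nbr_closed)
    moreover from this have "ascending (alternating d c (Suc i)) ?\<delta>"
      "fold nbr (alternating d c (Suc i)) ?\<delta> = \<gamma>"
      using \<delta>(4,5) by simp_all
    moreover have "(d, c) = (if odd (Suc i) then (a, b) else (b, a))"
      using \<delta>(3) by (auto split: if_splits)
    ultimately show ?thesis
      using ik by blast
  qed
qed

end

text \<open>A braid relation between the operators of any two labels. It is stated on basis vectors
  and extends to their finite combinations by linearity.\<close>

locale braided_digraph = matching_digraph +
  assumes braid: "r \<in> S \<Longrightarrow> s \<in> S \<Longrightarrow> r \<noteq> s \<Longrightarrow>
    \<exists>m>0. \<forall>q::rat. \<forall>\<alpha>\<in>V.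
      fold (act q) (alternating r s m) (delta \<alpha>) = fold (act q) (alternating s r m) (delta \<alpha>)"
begin

lemma step_diamond:
  assumes "step \<alpha> \<beta>" "step \<alpha> \<beta>'"
  shows "\<exists>\<gamma> i. (step ^^ i) \<beta> \<gamma> \<and> (step ^^ i) \<beta>' \<gamma>"
proof -
  obtain a b where ab: "a \<in> S" "b \<in> S" "out a \<alpha>" "out b \<alpha>" "\<alpha> \<in> V" "\<beta> = nbr a \<alpha>" "\<beta>' = nbr b \<alpha>"
    using assms by (auto simp: step_def)
  show ?thesis
  proof (cases "a = b")
    case True
    then have "(step ^^ 0) \<beta> \<beta> \<and> (step ^^ 0) \<beta>' \<beta>"
      using ab by simp
    then show ?thesis by blast
  next
    case False
    obtain m where "0 < m" "\<forall>q::rat. \<forall>\<alpha>\<in>V.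
        fold (act q) (alternating a b m) (delta \<alpha>) = fold (act q) (alternating b a m) (delta \<alpha>)"
      using braid[OF ab(1,2) False] by blast
    from alternating_meet[OF ab(1,2,5,3,4) this] obtain j where
      j: "0 < j" "ascending (alternating a b j) \<alpha>" "ascending (alternating b a j) \<alpha>"
      "fold nbr (alternating a b j) \<alpha> = fold nbr (alternating b a j) \<alpha>"
      by blast
    then obtain i where i: "j = Suc i"
      by (cases j) auto
    have "(step ^^ i) \<beta> (fold nbr (alternating b a i) \<beta>)"
      using step_relpowp_if_ascending[of "alternating b a i" \<beta>] j(2) i ab
      by (simp add: alternating_subset nbr_closed)
    moreover have "(step ^^ i) \<beta>' (fold nbr (alternating a b i) \<beta>')"
      using step_relpowp_if_ascending[of "alternating a b i" \<beta>'] j(3) i ab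
      by (simp add: alternating_subset nbr_closed)
    ultimately show ?thesis
      using j(4) i ab by auto
  qed
qed

text \<open>Walk backwards from \<open>\<gamma>\<close>, and let the braid relation have \<open>m\<close> letters on each side. If
  the walk lasted for \<open>m\<close> steps without meeting a vertex from which both edges go out,
  then at its last vertex \<open>\<delta>\<close> one side of the braid relation would give \<open>\<gamma>\<close> and the
  other, whose first letter only changes the sign, the negative of a vertex. So both edges go
  out from some \<open>\<delta>\<close>, the two alternating paths from it meet, and they can only meet at \<open>\<gamma>\<close>.
  Having equal length, they end with different labels, that is, in \<open>\<beta>\<close> and \<open>\<beta>'\<close> before the last step.\<close>

lemma step_codiamond:
  assumes "step \<beta> \<gamma>" "step \<beta>' \<gamma>"
  shows "\<exists>\<delta> i. (step ^^ i) \<delta> \<beta> \<and> (step ^^ i) \<delta> \<beta>'"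
proof -
  obtain a b where ab: "a \<in> S" "b \<in> S" "out a \<beta>" "out b \<beta>'" "\<beta> \<in> V" "\<beta>' \<in> V"
    "\<gamma> = nbr a \<beta>" "\<gamma> = nbr b \<beta>'"
    using assms by (auto simp: step_def)
  have \<gamma>: "\<gamma> \<in> V" "\<not> out a \<gamma>" "\<not> out b \<gamma>" "\<beta> = nbr a \<gamma>" "\<beta>' = nbr b \<gamma>"
    using ab nbr_closed out_nbr nbr_nbr by metis+
  show ?thesis
  proof (cases "a = b")
    case True
    then have "(step ^^ 0) \<beta> \<beta> \<and> (step ^^ 0) \<beta> \<beta>'"
      using \<gamma>(4,5) by simp
    then show ?thesis by blast
  next
    case False
    obtain m where m: "0 < m" and br: "\<forall>q::rat. \<forall>\<alpha>\<in>V.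
        fold (act q) (alternating a b m) (delta \<alpha>) = fold (act q) (alternating b a m) (delta \<alpha>)"
      using braid[OF ab(1,2) False] by blast
    obtain \<delta> i c d where \<delta>: "\<delta> \<in> V" "i \<le> m" "(c, d) = (if odd i then (a, b) else (b, a))"
      "ascending (alternating c d i) \<delta>" "fold nbr (alternating c d i) \<delta> = \<gamma>"
      and cases: "out c \<delta> \<and> out d \<delta> \<or> i = m \<and> \<not> out d \<delta>"
      using descend_alternating[OF ab(1,2) \<gamma>(1,2), of m] by blast
    have cd: "c \<in> S" "d \<in> S" "c \<noteq> d" "\<not> out c \<gamma>" "\<not> out d \<gamma>"
      using \<delta>(3) ab(1,2) False \<gamma>(2,3) by (auto split: if_splits)
    have br': "\<forall>q::rat. \<forall>\<alpha>\<in>V.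
        fold (act q) (alternating c d m) (delta \<alpha>) = fold (act q) (alternating d c m) (delta \<alpha>)"
      using br \<delta>(3) by (auto split: if_splits)
    have "\<not> (i = m \<and> \<not> out d \<delta>)"
    proof
      assume *: "i = m \<and> \<not> out d \<delta>"
      obtain l where l: "m = Suc l"
        using m by (cases m) auto
      let ?\<epsilon> = "fold nbr (alternating c d l) \<delta>"
      have "ascending (alternating c d (Suc l)) \<delta>"
        using \<delta>(4) * l by simp
      then have asc: "ascending (alternating c d l) \<delta>"
        unfolding alternating_snoc ascending_append by blast
      have "delta \<gamma> = fold (act (0::rat)) (alternating c d m) (delta \<delta>)"
        using fold_act_zero_ascending[OF \<delta>(4)] cd \<delta> * alternating_subset by simp
      also have "\<dots> = fold (act 0) (alternating c d l) (act 0 d (delta \<delta>))"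
        using br' \<delta>(1) l by simp
      also have "act (0::rat) d (delta \<delta>) = (\<lambda>\<beta>. - 1 * delta \<delta> \<beta>)"
        using act_zero_in cd(2) \<delta>(1) * by blast
      also have "fold (act 0) (alternating c d l) (\<lambda>\<beta>. - 1 * delta \<delta> \<beta>) =
          (\<lambda>\<beta>. - 1 * fold (act (0::rat)) (alternating c d l) (delta \<delta>) \<beta>)"
        by (rule fold_act_scale)
      also have "fold (act (0::rat)) (alternating c d l) (delta \<delta>) = delta ?\<epsilon>"
        using fold_act_zero_ascending[OF asc] cd \<delta>(1) alternating_subset by blast
      finally have "delta \<gamma> \<gamma> = - 1 * (delta ?\<epsilon> \<gamma> :: rat)"
        by metis
      then show False
        by (simp add: delta_def split: if_splits)
    qed
    then have outs: "out c \<delta>" "out d \<delta>"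
      using cases by auto
    obtain j where j: "0 < j" "j \<le> m" "ascending (alternating c d j) \<delta>"
      "ascending (alternating d c j) \<delta>"
      "fold nbr (alternating c d j) \<delta> = fold nbr (alternating d c j) \<delta>"
      "j = m \<or> \<not> out c (fold nbr (alternating c d j) \<delta>) \<and>
                \<not> out d (fold nbr (alternating c d j) \<delta>)"
      using alternating_meet[OF cd(1,2) \<delta>(1) outs m br'] by blast
    have "\<not> i < j"
      using ascending_alternating_out[OF j(3), of i] \<delta>(5) cd(4,5) by (auto split: if_splits)
    moreover have "\<not> j < i"
      using ascending_alternating_out[OF \<delta>(4), of j] j(6) \<delta>(2) by (auto split: if_splits)
    ultimately have "j = i"
      by simp
    then obtain l where l: "i = Suc l"
      using j(1) by (cases i) auto
    have backwards: "(step ^^ l) \<delta> (nbr t \<gamma>)"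
      if xy: "x \<in> S" "y \<in> S" and asc: "ascending (alternating x y (Suc l)) \<delta>"
        "fold nbr (alternating x y (Suc l)) \<delta> = \<gamma>" and t: "t = (if even l then x else y)" for x y t
    proof -
      let ?\<epsilon> = "fold nbr (alternating x y l) \<delta>"
      have "ascending (alternating x y l) \<delta>" "\<gamma> = nbr t ?\<epsilon>"
        using asc t unfolding alternating_snoc by (auto simp: ascending_append)
      moreover have "?\<epsilon> \<in> V" "t \<in> S"
        using fold_nbr_closed alternating_subset xy \<delta>(1) t by auto
      ultimately show ?thesis
        using step_relpowp_if_ascending[of "alternating x y l" \<delta>] alternating_subset xy \<delta>(1)
        by (simp add: nbr_nbr)
    qed
    have "(step ^^ l) \<delta> (nbr a \<gamma>)"
      using backwards[of c d a] cd \<delta>(3-5) l by (auto split: if_splits simp del: alternating.simps)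
    moreover have "(step ^^ l) \<delta> (nbr b \<gamma>)"
      using backwards[of d c b] cd \<delta>(3) j \<open>j = i\<close> l \<delta>(5)
      by (auto split: if_splits simp del: alternating.simps)
    ultimately show ?thesis
      using \<gamma> by blast
  qed
qed

end

section \<open>The operators of a labeled digraph\<close>

definition edge_of :: "('v, 'e, 's) labeled_digraph \<Rightarrow> 's \<Rightarrow> 'v \<Rightarrow> 'e" where
  "edge_of \<Gamma> s \<alpha> = (THE e. edge_at \<Gamma> s \<alpha> e)"

definition outgoing :: "('v, 'e, 's) labeled_digraph \<Rightarrow> 's \<Rightarrow> 'v \<Rightarrow> bool" where
  "outgoing \<Gamma> s \<alpha> \<longleftrightarrow> source_of \<Gamma> (edge_of \<Gamma> s \<alpha>) = \<alpha>"

definition neighbour :: "('v, 'e, 's) labeled_digraph \<Rightarrow> 's \<Rightarrow> 'v \<Rightarrow> 'v" where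
  "neighbour \<Gamma> s \<alpha> =
     (if outgoing \<Gamma> s \<alpha> then target_of \<Gamma> (edge_of \<Gamma> s \<alpha>) else source_of \<Gamma> (edge_of \<Gamma> s \<alpha>))"

definition dashed_at :: "('v, 'e, 's) labeled_digraph \<Rightarrow> 's \<Rightarrow> 'v \<Rightarrow> bool" where
  "dashed_at \<Gamma> s \<alpha> \<longleftrightarrow> dashed \<Gamma> (edge_of \<Gamma> s \<alpha>)"

lemma u_eq_to_fract: "u = to_fract [:0, 1:]"
  by (simp add: u_def to_fract_def)

lemma lookup_map_mult:
  "Poly_Mapping.lookup (Poly_Mapping.map ((*) c) x) \<alpha> = c * Poly_Mapping.lookup x \<alpha>"
  for c :: "'a::mult_zero"
  by (simp add: map.rep_eq when_def)

locale labeled_digraph_on =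
  fixes S :: "'s set" and \<Gamma> :: "('v, 'e, 's) labeled_digraph"
  assumes labeled: "S_labeled_digraph S \<Gamma>"
begin

sublocale loopfree_digraph "underlying \<Gamma>"
  using labeled by (simp add: S_labeled_digraph_def)

lemma edge_at_unique:
  "s \<in> S \<Longrightarrow> \<alpha> \<in> vertices \<Gamma> \<Longrightarrow> \<exists>!e. edge_at \<Gamma> s \<alpha> e"
  using labeled by (simp add: S_labeled_digraph_def)

lemma edge_at_edge_of: "s \<in> S \<Longrightarrow> \<alpha> \<in> vertices \<Gamma> \<Longrightarrow> edge_at \<Gamma> s \<alpha> (edge_of \<Gamma> s \<alpha>)"
  unfolding edge_of_def by (rule theI') (rule edge_at_unique)

lemma edge_of_eq:
  assumes "s \<in> S" "\<alpha> \<in> vertices \<Gamma>" "edge_at \<Gamma> s \<alpha> e"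
  shows "edge_of \<Gamma> s \<alpha> = e"
  using edge_at_unique[OF assms(1,2)] edge_at_edge_of[OF assms(1,2)] assms(3) by blast

lemma label_in: "e \<in> edges \<Gamma> \<Longrightarrow> label \<Gamma> e \<in> S"
  using labeled by (simp add: S_labeled_digraph_def)

sublocale matching_digraph "vertices \<Gamma>" S "neighbour \<Gamma>" "outgoing \<Gamma>" "dashed_at \<Gamma>"
proof
  fix s \<alpha>
  assume s: "s \<in> S" "\<alpha> \<in> vertices \<Gamma>"
  let ?e = "edge_of \<Gamma> s \<alpha>"
  have e: "?e \<in> edges \<Gamma>" "label \<Gamma> ?e = s" "source_of \<Gamma> ?e = \<alpha> \<or> target_of \<Gamma> ?e = \<alpha>"
    using edge_at_edge_of[OF s] by (auto simp: edge_at_def)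
  show V: "neighbour \<Gamma> s \<alpha> \<in> vertices \<Gamma>"
    using e(1) by (simp add: neighbour_def)
  have "edge_at \<Gamma> s (neighbour \<Gamma> s \<alpha>) ?e"
    using e by (auto simp: edge_at_def neighbour_def)
  then have e': "edge_of \<Gamma> s (neighbour \<Gamma> s \<alpha>) = ?e"
    using edge_of_eq s(1) V by blast
  show "outgoing \<Gamma> s (neighbour \<Gamma> s \<alpha>) \<longleftrightarrow> \<not> outgoing \<Gamma> s \<alpha>"
    using e no_loops[OF e(1)] unfolding outgoing_def e' by (auto simp: neighbour_def outgoing_def)
  then show "neighbour \<Gamma> s (neighbour \<Gamma> s \<alpha>) = \<alpha>"
    using e unfolding neighbour_def[of \<Gamma> s "neighbour \<Gamma> s \<alpha>"] e' by (auto simp: outgoing_def)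
  show "dashed_at \<Gamma> s (neighbour \<Gamma> s \<alpha>) \<longleftrightarrow> dashed_at \<Gamma> s \<alpha>"
    by (simp add: dashed_at_def e')
qed

lemma step_iff: "step \<alpha> \<beta> \<longleftrightarrow> (\<exists>e\<in>edges \<Gamma>. source_of \<Gamma> e = \<alpha> \<and> target_of \<Gamma> e = \<beta>)"
proof
  assume "step \<alpha> \<beta>"
  then obtain s where s: "\<alpha> \<in> vertices \<Gamma>" "s \<in> S" "outgoing \<Gamma> s \<alpha>" "\<beta> = neighbour \<Gamma> s \<alpha>"
    by (auto simp: step_def)
  then show "\<exists>e\<in>edges \<Gamma>. source_of \<Gamma> e = \<alpha> \<and> target_of \<Gamma> e = \<beta>"
    using edge_at_edge_of[of s \<alpha>]
    by (auto simp: edge_at_def neighbour_def outgoing_def intro!: bexI[of _ "edge_of \<Gamma> s \<alpha>"])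
next
  assume "\<exists>e\<in>edges \<Gamma>. source_of \<Gamma> e = \<alpha> \<and> target_of \<Gamma> e = \<beta>"
  then obtain e where e: "e \<in> edges \<Gamma>" "source_of \<Gamma> e = \<alpha>" "target_of \<Gamma> e = \<beta>"
    by blast
  have V: "\<alpha> \<in> vertices \<Gamma>"
    using e tail_in_verts by blast
  have "edge_of \<Gamma> (label \<Gamma> e) \<alpha> = e"
    using e V label_in by (intro edge_of_eq) (auto simp: edge_at_def)
  then have "outgoing \<Gamma> (label \<Gamma> e) \<alpha>" "\<beta> = neighbour \<Gamma> (label \<Gamma> e) \<alpha>"
    using e by (auto simp: outgoing_def neighbour_def)
  then show "step \<alpha> \<beta>"
    using V label_in[OF e(1)] by (auto simp: step_def)
qed

lemma is_source_iff: "is_source \<Gamma> \<alpha> \<longleftrightarrow> \<alpha> \<in> vertices \<Gamma> \<and> (\<forall>\<beta>. \<not> step \<beta> \<alpha>)"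
  by (auto simp: is_source_def in_arcs_def step_iff)

lemma is_sink_iff: "is_sink \<Gamma> \<alpha> \<longleftrightarrow> \<alpha> \<in> vertices \<Gamma> \<and> (\<forall>\<beta>. \<not> step \<alpha> \<beta>)"
  by (auto simp: is_sink_def out_arcs_def step_iff)

lemma acyclic_if_step_acyclic:
  assumes "\<And>\<alpha>. \<alpha> \<in> vertices \<Gamma> \<Longrightarrow> \<not> step\<^sup>+\<^sup>+ \<alpha> \<alpha>"
  shows "acyclic_digraph \<Gamma>"
proof -
  have cas: "step\<^sup>*\<^sup>* \<alpha> \<beta>" if "cas \<alpha> p \<beta>" "set p \<subseteq> edges \<Gamma>" for \<alpha> p \<beta>
    using that
  proof (induction p arbitrary: \<alpha>)
    case (Cons e p)
    then have "step \<alpha> (target_of \<Gamma> e)"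
      by (auto simp: step_iff)
    moreover have "step\<^sup>*\<^sup>* (target_of \<Gamma> e) \<beta>"
      using Cons by simp
    ultimately show ?case
      by (rule converse_rtranclp_into_rtranclp)
  qed simp
  have "\<not> awalk \<alpha> p \<alpha>" if ne: "p \<noteq> []" for \<alpha> p
  proof
    assume walk: "awalk \<alpha> p \<alpha>"
    obtain e p' where p: "p = e # p'"
      using ne by (cases p) auto
    then have "step \<alpha> (target_of \<Gamma> e)"
      using walk by (auto simp: awalk_def step_iff)
    moreover have "step\<^sup>*\<^sup>* (target_of \<Gamma> e) \<alpha>"
      using walk p cas[of "target_of \<Gamma> e" p' \<alpha>] by (simp add: awalk_def)
    ultimately have "step\<^sup>+\<^sup>+ \<alpha> \<alpha>"
      by (rule rtranclp_into_tranclp2)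
    then show False
      using assms walk by (auto simp: awalk_def)
  qed
  then show ?thesis
    by (auto simp: acyclic_digraph_def)
qed

lemma connected_step:
  assumes "connected_digraph \<Gamma>" "\<alpha> \<in> vertices \<Gamma>" "\<beta> \<in> vertices \<Gamma>"
  shows "(\<lambda>x y. step x y \<or> step y x)\<^sup>*\<^sup>* \<alpha> \<beta>"
proof -
  have "(\<alpha>, \<beta>) \<in> rtrancl_on (vertices \<Gamma>) (symcl (arcs_ends (underlying \<Gamma>)))"
    using assms unfolding connected_digraph_def connected_conv by simp
  then have "(\<alpha>, \<beta>) \<in> (symcl (arcs_ends (underlying \<Gamma>)))\<^sup>*"
    by (rule rtrancl_on_rtranclI)
  moreover have "symcl (arcs_ends (underlying \<Gamma>)) = {(x, y). step x y \<or> step y x}"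
    by (auto simp: symcl_def arcs_ends_def arc_to_ends_def step_iff)
  ultimately show ?thesis
    by (simp add: rtranclp_rtrancl_eq)
qed

lemma foldr_act_hom:
  fixes h :: "'a::comm_ring_1 \<Rightarrow> 'b::comm_ring_1"
  assumes "\<And>x y. h (x + y) = h x + h y" "\<And>x y. h (x - y) = h x - h y"
    and "\<And>x y. h (x * y) = h x * h y" "h 1 = 1"
  shows "h (foldr (act q) ss x \<alpha>) = foldr (act (h q)) ss (\<lambda>\<beta>. h (x \<beta>)) \<alpha>"
proof (induction ss arbitrary: \<alpha>)
  case (Cons s ss)
  have "h 0 = 0"
    using assms(2)[of 0 0] by simp
  then show ?case
    using Cons assms by (simp add: act_def diag_def off_def power2_eq_square)
qed simp

text \<open>An identity over the rational functions between vectors with polynomial coefficients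
  already holds over the polynomials, where the indeterminate can be evaluated.\<close>

lemma specialize:
  assumes "\<And>\<beta>. foldr (act u) xs (delta \<alpha>) \<beta> =
      to_fract c * foldr (act u) ys (delta \<alpha>) \<beta> + to_fract d * foldr (act u) zs (delta \<alpha>) \<beta>"
  shows "foldr (act q) xs (delta \<alpha>) \<beta> =
      poly c q * foldr (act q) ys (delta \<alpha>) \<beta> + poly d q * foldr (act q) zs (delta \<alpha>) \<beta>"
proof -
  let ?F = "\<lambda>ss. foldr (act [:0, 1:]) ss (delta \<alpha>) \<beta>"
  have fract: "foldr (act u) ss (delta \<alpha>) \<beta> = to_fract (?F ss)" for ss
  proof -
    have "to_fract (?F ss) = foldr (act u) ss (\<lambda>\<beta>. to_fract (delta \<alpha> \<beta>)) \<beta>"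
      unfolding u_eq_to_fract by (rule foldr_act_hom) simp_all
    also have "(\<lambda>\<beta>. to_fract (delta \<alpha> \<beta>)) = delta \<alpha>"
      by (simp add: delta_def fun_eq_iff)
    finally show ?thesis ..
  qed
  have eval: "poly (?F ss) q = foldr (act q) ss (delta \<alpha>) \<beta>" for ss
  proof -
    have "poly (?F ss) q = foldr (act (poly [:0, 1:] q)) ss (\<lambda>\<beta>. poly (delta \<alpha> \<beta>) q) \<beta>"
      by (rule foldr_act_hom) simp_all
    also have "(\<lambda>\<beta>. poly (delta \<alpha> \<beta>) q) = delta \<alpha>"
      by (simp add: delta_def fun_eq_iff)
    finally show ?thesis by simp
  qed
  have "to_fract (?F xs) = to_fract (c * ?F ys + d * ?F zs)"
    using assms[of \<beta>] unfolding fract by simp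
  then have "?F xs = c * ?F ys + d * ?F zs"
    by (simp only: to_fract_eq_iff)
  then have "poly (?F xs) q = poly (c * ?F ys + d * ?F zs) q"
    by simp
  then show ?thesis
    by (simp add: eval)
qed

text \<open>This links the operators of the definition of a \<open>W\<close>-digraph to their coordinate form.\<close>

lemma lookup_tau:
  assumes "s \<in> S" "x \<in> carrier (vertex_module \<Gamma>)"
  shows "Poly_Mapping.lookup (tau \<Gamma> s x) = act u s (Poly_Mapping.lookup x)"
proof
  fix \<beta>
  let ?x = "Poly_Mapping.lookup x" and ?K = "Poly_Mapping.keys x"
  have K: "?K \<subseteq> vertices \<Gamma>"
    using assms(2) by (simp add: vertex_module_def)
  have x0: "?x \<gamma> = 0" if "\<gamma> \<notin> ?K" for \<gamma>
    using that by (simp add: in_keys_iff)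
  have vertex: "Poly_Mapping.lookup (tau_vertex \<Gamma> s \<alpha>) \<beta> =
      diag u s \<alpha> * delta \<alpha> \<beta> + off u s \<alpha> * delta (neighbour \<Gamma> s \<alpha>) \<beta>" for \<alpha>
    unfolding tau_vertex_def edge_of_def[symmetric] Let_def
    by (auto simp: diag_def off_def neighbour_def dashed_at_def outgoing_def delta_def
        lookup_add lookup_single when_def)
  have "Poly_Mapping.lookup (tau \<Gamma> s x) \<beta> =
      (\<Sum>\<alpha>\<in>?K. ?x \<alpha> * (diag u s \<alpha> * delta \<alpha> \<beta> + off u s \<alpha> * delta (neighbour \<Gamma> s \<alpha>) \<beta>))"
    using assms(2)
    by (simp add: tau_def vertex_module_def lookup_sum lookup_map_mult vertex)
  also have "\<dots> = (\<Sum>\<alpha>\<in>?K. if \<alpha> = \<beta> then ?x \<alpha> * diag u s \<alpha> else 0) +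
      (\<Sum>\<alpha>\<in>?K. if neighbour \<Gamma> s \<alpha> = \<beta> then ?x \<alpha> * off u s \<alpha> else 0)"
    unfolding sum.distrib[symmetric]
    by (intro sum.cong refl) (auto simp: delta_def algebra_simps)
  also have "(\<Sum>\<alpha>\<in>?K. if \<alpha> = \<beta> then ?x \<alpha> * diag u s \<alpha> else 0) = ?x \<beta> * diag u s \<beta>"
    using x0 by (simp add: sum.delta')
  also have "(\<Sum>\<alpha>\<in>?K. if neighbour \<Gamma> s \<alpha> = \<beta> then ?x \<alpha> * off u s \<alpha> else 0) =
      (if \<beta> \<in> vertices \<Gamma> then ?x (neighbour \<Gamma> s \<beta>) * off u s (neighbour \<Gamma> s \<beta>) else 0)"
  proof (cases "\<beta> \<in> vertices \<Gamma>")
    case True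
    have "neighbour \<Gamma> s \<alpha> = \<beta> \<longleftrightarrow> \<alpha> = neighbour \<Gamma> s \<beta>" if "\<alpha> \<in> ?K" for \<alpha>
      using that K nbr_nbr[OF assms(1) True] nbr_nbr[OF assms(1), of \<alpha>] by auto
    then have "(\<Sum>\<alpha>\<in>?K. if neighbour \<Gamma> s \<alpha> = \<beta> then ?x \<alpha> * off u s \<alpha> else 0) =
      (\<Sum>\<alpha>\<in>?K. if \<alpha> = neighbour \<Gamma> s \<beta> then ?x \<alpha> * off u s \<alpha> else 0)"
      by (intro sum.cong) auto
    then show ?thesis
      using x0 True by (simp add: sum.delta')
  next
    case False
    then have "neighbour \<Gamma> s \<alpha> \<noteq> \<beta>" if "\<alpha> \<in> ?K" for \<alpha>
      using that K nbr_closed[OF assms(1), of \<alpha>] by auto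
    then show ?thesis
      using False by (simp add: sum.neutral)
  qed
  also have "?x \<beta> * diag u s \<beta> +
      (if \<beta> \<in> vertices \<Gamma> then ?x (neighbour \<Gamma> s \<beta>) * off u s (neighbour \<Gamma> s \<beta>) else 0) =
      act u s ?x \<beta>"
    using K x0[of \<beta>] by (auto simp: act_def algebra_simps)
  finally show "Poly_Mapping.lookup (tau \<Gamma> s x) \<beta> = act u s ?x \<beta>" .
qed

end

section \<open>Relations inherited from the Hecke algebra\<close>

locale W_digraph_action =
  fixes W :: "('w, 'm) monoid_scheme" and S :: "'w set" and n :: "'w \<Rightarrow> 'w \<Rightarrow> enat"
    and H :: "(ratfun, 'h) module" and T :: "'w \<Rightarrow> 'h"
    and \<Gamma> :: "('v, 'e, 'w) labeled_digraph" and \<phi> :: "'h \<Rightarrow> ('v \<Rightarrow>\<^sub>0 ratfun) \<Rightarrow> ('v \<Rightarrow>\<^sub>0 ratfun)"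
  assumes coxeter: "coxeter_system W S n"
    and hecke: "hecke_algebra W S H T"
    and labeled_digraph: "S_labeled_digraph S \<Gamma>"
    and hom: "\<phi> \<in> algebra_hom Qu H (End_algebra Qu (vertex_module \<Gamma>))"
    and generators: "s \<in> S \<Longrightarrow> \<phi> (T s) = tau \<Gamma> s"
begin

sublocale cox: coxeter_system W S n
  by (rule coxeter)

sublocale labeled_digraph_on S \<Gamma>
  by standard (rule labeled_digraph)

abbreviation M where "M \<equiv> vertex_module \<Gamma>"

lemma T_closed: "w \<in> carrier W \<Longrightarrow> T w \<in> carrier H"
  using hecke_algebra.basis[OF hecke] by (simp add: is_basis_def)

lemma phi_closed: "a \<in> carrier H \<Longrightarrow> x \<in> carrier M \<Longrightarrow> \<phi> a x \<in> carrier M"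
  using hom by (auto simp: algebra_hom_def ring_hom_def End_algebra_def linear_operators_def)

lemma phi_mult:
  "a \<in> carrier H \<Longrightarrow> b \<in> carrier H \<Longrightarrow> x \<in> carrier M \<Longrightarrow> \<phi> (a \<otimes>\<^bsub>H\<^esub> b) x = \<phi> a (\<phi> b x)"
  using hom by (auto simp: algebra_hom_def ring_hom_def End_algebra_def compose_def)

lemma phi_add:
  "a \<in> carrier H \<Longrightarrow> b \<in> carrier H \<Longrightarrow> x \<in> carrier M \<Longrightarrow> \<phi> (a \<oplus>\<^bsub>H\<^esub> b) x = \<phi> a x + \<phi> b x"
  using hom by (auto simp: algebra_hom_def ring_hom_def End_algebra_def vertex_module_def)

lemma lookup_phi_smult:
  "a \<in> carrier H \<Longrightarrow> x \<in> carrier M \<Longrightarrow>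
     Poly_Mapping.lookup (\<phi> (c \<odot>\<^bsub>H\<^esub> a) x) \<beta> = c * Poly_Mapping.lookup (\<phi> a x) \<beta>"
  using hom by (auto simp: algebra_hom_def End_algebra_def vertex_module_def
      ring_of_type_algebra_def lookup_map_mult)

lemma tau_closed: "s \<in> S \<Longrightarrow> x \<in> carrier M \<Longrightarrow> tau \<Gamma> s x \<in> carrier M"
  using phi_closed T_closed generators cox.generators_closed by metis

text \<open>The empty word is excluded because the axioms do not say that \<open>T\<close> of the neutral
  element is the unit of the algebra.\<close>

lemma phi_T_reduced:
  "cox.reduced xs \<Longrightarrow> xs \<noteq> [] \<Longrightarrow> x \<in> carrier M \<Longrightarrow>
     \<phi> (T (cox.list_prod xs)) x = foldr (tau \<Gamma>) xs x"
proof (induction xs)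
  case (Cons s xs)
  have S: "s \<in> S" "set xs \<subseteq> S" and tail: "cox.reduced xs"
    using Cons.prems cox.reduced_tail by (auto simp: cox.reduced_def)
  show ?case
  proof (cases "xs = []")
    case True
    then show ?thesis
      using S generators cox.generators_closed by simp
  next
    case False
    let ?w = "cox.list_prod xs"
    have w: "?w \<in> carrier W"
      using S(2) cox.words_closed cox.list_prod_closed by blast
    have "cox.len (s \<otimes>\<^bsub>W\<^esub> ?w) > cox.len ?w"
      using Cons.prems(1) tail by (simp add: cox.reduced_def)
    then have "T (s \<otimes>\<^bsub>W\<^esub> ?w) = T s \<otimes>\<^bsub>H\<^esub> T ?w"
      using hecke_algebra.T_mult_up[OF hecke S(1) w] by simp
    then have "\<phi> (T (s \<otimes>\<^bsub>W\<^esub> ?w)) x = \<phi> (T s) (\<phi> (T ?w) x)"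
      using phi_mult T_closed w S(1) cox.generators_closed Cons.prems(3) by simp
    then show ?thesis
      using Cons.IH[OF tail False Cons.prems(3)] generators S(1) by simp
  qed
qed simp

lemma foldr_tau:
  "set xs \<subseteq> S \<Longrightarrow> x \<in> carrier M \<Longrightarrow> foldr (tau \<Gamma>) xs x \<in> carrier M \<and>
     Poly_Mapping.lookup (foldr (tau \<Gamma>) xs x) = foldr (act u) xs (Poly_Mapping.lookup x)"
  by (induction xs) (simp_all add: lookup_tau tau_closed)

lemma lookup_phi_T_reduced:
  assumes "cox.reduced xs" "xs \<noteq> []" "\<alpha> \<in> vertices \<Gamma>"
  shows "Poly_Mapping.lookup (\<phi> (T (cox.list_prod xs)) (Poly_Mapping.single \<alpha> 1)) =
    foldr (act u) xs (delta \<alpha>)"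
proof -
  have "Poly_Mapping.single \<alpha> 1 \<in> carrier M"
    using assms(3) by (simp add: vertex_module_def)
  moreover have "Poly_Mapping.lookup (Poly_Mapping.single \<alpha> (1::ratfun)) = delta \<alpha>"
    by (auto simp: fun_eq_iff delta_def lookup_single when_def)
  ultimately show ?thesis
    using phi_T_reduced[OF assms(1,2)] foldr_tau[of xs] assms(1) by (simp add: cox.reduced_def)
qed

lemma braid_relation:
  assumes rs: "r \<in> S" "s \<in> S" "r \<noteq> s" and \<alpha>: "\<alpha> \<in> vertices \<Gamma>"
    and pos: "0 < cox.ord (r \<otimes>\<^bsub>W\<^esub> s)"
  defines "m \<equiv> cox.ord (r \<otimes>\<^bsub>W\<^esub> s)"
  shows "fold (act q) (alternating r s m) (delta \<alpha>) =
    fold (act (q::rat)) (alternating s r m) (delta \<alpha>)"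
proof -
  have red: "cox.reduced (alternating r s m)"
    using cox.reduced_alternating rs by (simp add: m_def)
  have prod: "cox.list_prod (alternating r s m) = cox.list_prod (alternating s r m)"
    unfolding m_def using cox.list_prod_alternating_ord rs by blast
  have red': "cox.reduced (alternating s r m)"
    using red prod set_alternating[of s r m] rs by (auto simp: cox.reduced_def)
  have ne: "alternating r s m \<noteq> []" "alternating s r m \<noteq> []"
    using pos by (simp_all add: m_def flip: length_0_conv)
  have "foldr (act u) (alternating r s m) (delta \<alpha>) = foldr (act u) (alternating s r m) (delta \<alpha>)"
    using lookup_phi_T_reduced[OF red ne(1) \<alpha>] lookup_phi_T_reduced[OF red' ne(2) \<alpha>] prod by simp
  then have "foldr (act q) (alternating r s m) (delta \<alpha>) \<beta> =
      foldr (act q) (alternating s r m) (delta \<alpha>) \<beta>" for \<beta>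
    using specialize[of "alternating r s m" \<alpha> 1 "alternating s r m" 0 "[]" q] by simp
  then have "foldr (act q) (alternating r s m) (delta \<alpha>) =
      foldr (act q) (alternating s r m) (delta \<alpha>)"
    by (rule ext)
  then show ?thesis
    by (simp add: foldr_conv_fold rev_alternating split: if_splits)
qed

text \<open>If the path \<open>ss\<close> has a reduced word with product \<open>w\<close> and its extension by \<open>s\<close> has not, then
  \<open>s\<close> shortens \<open>w\<close> and the formula for \<open>T\<^sub>s T\<^sub>w\<close> specializes at \<open>u = 0\<close> to \<open>\<tau>\<^sub>s e = - e\<close>, where \<open>e\<close>
  is the end of \<open>ss\<close>. But \<open>\<tau>\<^sub>s e\<close> is the next vertex of the path.\<close>

lemma reduced_if_ascending:
  assumes "\<alpha> \<in> vertices \<Gamma>"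
  shows "ascending ss \<alpha> \<Longrightarrow> set ss \<subseteq> S \<Longrightarrow> cox.reduced (rev ss)"
proof (induction ss rule: rev_induct)
  case Nil
  have "cox.len (cox.list_prod []) \<le> 0"
    using cox.len_le[of "[]"] by simp
  then show ?case
    by (simp add: cox.reduced_def)
next
  case (snoc s ss)
  let ?w = "cox.list_prod (rev ss)" and ?e = "fold (neighbour \<Gamma>) ss \<alpha>"
  have asc: "ascending ss \<alpha>" "outgoing \<Gamma> s ?e" and S: "s \<in> S" "set ss \<subseteq> S"
    using snoc.prems by (auto simp: ascending_append)
  have red: "cox.reduced (rev ss)"
    using snoc.IH asc(1) S(2) by blast
  have w: "?w \<in> carrier W" "s \<otimes>\<^bsub>W\<^esub> ?w \<in> carrier W"
    using S cox.words_closed[of "rev ss"] cox.list_prod_closed[of "rev ss"]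
      cox.generators_closed by simp_all
  have len: "cox.len ?w = length ss"
    using red by (simp add: cox.reduced_def)
  have e: "?e \<in> vertices \<Gamma>"
    using fold_nbr_closed S(2) assms by blast
  show ?case
  proof (cases "cox.len ?w < cox.len (s \<otimes>\<^bsub>W\<^esub> ?w)")
    case True
    moreover have "cox.len (cox.list_prod (s # rev ss)) \<le> length (s # rev ss)"
      using S by (intro cox.len_le) simp
    ultimately show ?thesis
      using S len by (simp add: cox.reduced_def)
  next
    case False
    then have down: "cox.len (s \<otimes>\<^bsub>W\<^esub> ?w) < cox.len ?w"
      using cox.len_generator_mult_neq[OF S(1) w(1)] by simp
    obtain ys where ys: "cox.reduced ys" "cox.list_prod ys = s \<otimes>\<^bsub>W\<^esub> ?w"
      using cox.obtain_reduced w(2) by metis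
    have ne: "ss \<noteq> []"
      using down len by auto
    \<comment> \<open>If \<open>s w\<close> is neutral, then \<open>w = s\<close>, and an edge labeled \<open>s\<close> cannot follow the edge
      labeled \<open>s\<close>.\<close>
    have "ys \<noteq> []"
    proof
      assume "ys = []"
      then have "s \<otimes>\<^bsub>W\<^esub> ?w = s \<otimes>\<^bsub>W\<^esub> s"
        using ys(2) cox.involution[OF S(1)] by simp
      then have "?w = s"
        using w(1) S(1) cox.generators_closed by simp
      then have "cox.len ?w \<le> 1"
        using cox.len_le[of "[s]"] S(1) cox.generators_closed by simp
      then obtain t where t: "ss = [t]"
        using ne len by (cases ss) auto
      then have "t = s"
        using \<open>?w = s\<close> S cox.generators_closed by simp
      then show False
        using asc t out_nbr[OF S(1) assms] by simp
    qed
    let ?x = "Poly_Mapping.single \<alpha> 1"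
    have x: "?x \<in> carrier M"
      using assms by (simp add: vertex_module_def)
    have T: "T ?w \<in> carrier H" "T (s \<otimes>\<^bsub>W\<^esub> ?w) \<in> carrier H" "T s \<in> carrier H"
      using T_closed w S(1) cox.generators_closed by simp_all
    interpret hecke_algebra W S H T
      by (rule hecke)
    have smult: "c \<odot>\<^bsub>H\<^esub> a \<in> carrier H" if "a \<in> carrier H" for c a
      using that by (intro smult_closed) (auto simp: ring_of_type_algebra_def)
    have "\<phi> (T s \<otimes>\<^bsub>H\<^esub> T ?w) ?x =
        \<phi> (u\<^sup>2 \<odot>\<^bsub>H\<^esub> T (s \<otimes>\<^bsub>W\<^esub> ?w) \<oplus>\<^bsub>H\<^esub> (u\<^sup>2 - 1) \<odot>\<^bsub>H\<^esub> T ?w) ?x"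
      using T_mult_down[OF S(1) w(1) down] by simp
    then have "tau \<Gamma> s (\<phi> (T ?w) ?x) =
        \<phi> (u\<^sup>2 \<odot>\<^bsub>H\<^esub> T (s \<otimes>\<^bsub>W\<^esub> ?w)) ?x + \<phi> ((u\<^sup>2 - 1) \<odot>\<^bsub>H\<^esub> T ?w) ?x"
      using T smult x generators[OF S(1)] by (simp add: phi_mult phi_add)
    then have "Poly_Mapping.lookup (tau \<Gamma> s (\<phi> (T ?w) ?x)) \<beta> =
        u\<^sup>2 * Poly_Mapping.lookup (\<phi> (T (s \<otimes>\<^bsub>W\<^esub> ?w)) ?x) \<beta> +
        (u\<^sup>2 - 1) * Poly_Mapping.lookup (\<phi> (T ?w) ?x) \<beta>" for \<beta>
      using T x by (simp add: lookup_add lookup_phi_smult)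
    then have "foldr (act u) (s # rev ss) (delta \<alpha>) \<beta> =
        u\<^sup>2 * foldr (act u) ys (delta \<alpha>) \<beta> + (u\<^sup>2 - 1) * foldr (act u) (rev ss) (delta \<alpha>) \<beta>" for \<beta>
      using lookup_tau[OF S(1) phi_closed[OF T(1) x]] lookup_phi_T_reduced[OF red _ assms] ne
        lookup_phi_T_reduced[OF ys(1) \<open>ys \<noteq> []\<close> assms] ys(2)
      by simp
    moreover have "u\<^sup>2 = to_fract ([:0, 1:]\<^sup>2)" "u\<^sup>2 - 1 = to_fract ([:0, 1:]\<^sup>2 - 1)"
      unfolding u_eq_to_fract by (simp_all only: power2_eq_square to_fract_mult to_fract_diff to_fract_1)
    ultimately have "foldr (act (0::rat)) (s # rev ss) (delta \<alpha>) \<beta> =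
        - foldr (act 0) (rev ss) (delta \<alpha>) \<beta>" for \<beta>
      using specialize[of "s # rev ss" \<alpha> "[:0, 1:]\<^sup>2" ys "[:0, 1:]\<^sup>2 - 1" "rev ss" 0 \<beta>] by simp
    moreover have "foldr (act (0::rat)) (rev ss) (delta \<alpha>) = delta ?e"
      using fold_act_zero_ascending[OF asc(1) S(2) assms] by (simp add: foldr_conv_fold)
    ultimately have "act (0::rat) s (delta ?e) \<beta> = - delta ?e \<beta>" for \<beta>
      by simp
    then have "delta (neighbour \<Gamma> s ?e) \<beta> = - (delta ?e \<beta> :: rat)" for \<beta>
      using act_zero_out[OF S(1) e asc(2)] by simp
    from this[of "neighbour \<Gamma> s ?e"] show ?thesis
      by (simp add: delta_def split: if_splits)
  qed
qed

end

section \<open>Sources, sinks and circuits\<close>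

theorem theorem1p5:
  fixes W :: "('w, 'm) monoid_scheme"
    and S :: "'w set"
    and n :: "'w \<Rightarrow> 'w \<Rightarrow> enat"
    and H :: "(ratfun, 'h) module"
    and T :: "'w \<Rightarrow> 'h"
    and \<Gamma> :: "('v, 'e, 'w) labeled_digraph"
  assumes "coxeter_system W S n"
    and "hecke_algebra W S H T"
    and "\<forall>s \<in> S. \<forall>t \<in> S. n s t < \<infinity>"
    and "W_digraph S H T \<Gamma>"
    and "connected_digraph \<Gamma>"
  shows "((\<forall>\<alpha> \<beta>. is_source \<Gamma> \<alpha> \<and> is_source \<Gamma> \<beta> \<longrightarrow> \<alpha> = \<beta>) \<and>
          (\<forall>\<alpha> \<beta>. is_sink \<Gamma> \<alpha> \<and> is_sink \<Gamma> \<beta> \<longrightarrow> \<alpha> = \<beta>)) \<and>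
         ((\<exists>\<alpha>. is_source \<Gamma> \<alpha> \<or> is_sink \<Gamma> \<alpha>) \<longrightarrow> acyclic_digraph \<Gamma>) \<and>
         (finite (carrier W) \<longrightarrow>
            (\<exists>\<alpha>. is_source \<Gamma> \<alpha>) \<and> (\<exists>\<alpha>. is_sink \<Gamma> \<alpha>) \<and> acyclic_digraph \<Gamma>)"
proof -
  obtain \<phi> where \<phi>: "S_labeled_digraph S \<Gamma>"
    "\<phi> \<in> algebra_hom Qu H (End_algebra Qu (vertex_module \<Gamma>))" "\<forall>s\<in>S. \<phi> (T s) = tau \<Gamma> s"
    using assms(4) by (auto simp: W_digraph_def)
  interpret W_digraph_action W S n H T \<Gamma> \<phi>
    using assms(1,2) \<phi> by (intro W_digraph_action.intro) auto
  interpret braided_digraph "vertices \<Gamma>" S "neighbour \<Gamma>" "outgoing \<Gamma>" "dashed_at \<Gamma>"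
  proof
    fix r s
    assume "r \<in> S" "s \<in> S" "r \<noteq> s"
    moreover from this have "0 < cox.ord (r \<otimes>\<^bsub>W\<^esub> s)"
      using cox.ord_pos assms(3) by blast
    ultimately show "\<exists>m>0. \<forall>q::rat. \<forall>\<alpha>\<in>vertices \<Gamma>.
        fold (act q) (alternating r s m) (delta \<alpha>) = fold (act q) (alternating s r m) (delta \<alpha>)"
      using braid_relation by blast
  qed
  have down: "balanced step"
    unfolding balanced_def using step_diamond by blast
  have up: "balanced step\<inverse>\<inverse>"
    unfolding balanced_def using step_codiamond by (simp add: relpowp_conversep)
  have conn: "(\<lambda>x y. step x y \<or> step y x)\<^sup>*\<^sup>* \<alpha> \<beta>"
    if "\<alpha> \<in> vertices \<Gamma>" "\<beta> \<in> vertices \<Gamma>" for \<alpha> \<beta>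
    using connected_step assms(5) that by blast
  have conn': "(\<lambda>x y. step\<inverse>\<inverse> x y \<or> step\<inverse>\<inverse> y x)\<^sup>*\<^sup>* \<alpha> \<beta>"
    if "\<alpha> \<in> vertices \<Gamma>" "\<beta> \<in> vertices \<Gamma>" for \<alpha> \<beta>
    using conn[OF that] by (simp add: disj_commute)
  have source_unique: "\<alpha> = \<beta>" if "is_source \<Gamma> \<alpha>" "is_source \<Gamma> \<beta>" for \<alpha> \<beta>
    using balanced_component_unique_normal_form[OF up, of \<beta> \<alpha>] that conn'
    by (simp add: is_source_iff)
  have sink_unique: "\<alpha> = \<beta>" if "is_sink \<Gamma> \<alpha>" "is_sink \<Gamma> \<beta>" for \<alpha> \<beta>
    using balanced_component_unique_normal_form[OF down, of \<beta> \<alpha>] that conn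
    by (simp add: is_sink_iff)
  have acyclic: "acyclic_digraph \<Gamma>" if "is_source \<Gamma> \<alpha> \<or> is_sink \<Gamma> \<alpha>" for \<alpha>
    using that
  proof
    assume "is_source \<Gamma> \<alpha>"
    then have "\<not> step\<inverse>\<inverse>\<^sup>+\<^sup>+ \<beta> \<beta>" if "\<beta> \<in> vertices \<Gamma>" for \<beta>
      using balanced_component_acyclic[OF up, of \<alpha> \<beta>] conn' that by (simp add: is_source_iff)
    then show ?thesis
      by (intro acyclic_if_step_acyclic) (simp add: tranclp_converse)
  next
    assume "is_sink \<Gamma> \<alpha>"
    then have "\<not> step\<^sup>+\<^sup>+ \<beta> \<beta>" if "\<beta> \<in> vertices \<Gamma>" for \<beta>
      using balanced_component_acyclic[OF down, of \<alpha> \<beta>] conn that by (simp add: is_sink_iff)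
    then show ?thesis
      by (rule acyclic_if_step_acyclic)
  qed
  have finite_case: "(\<exists>\<alpha>. is_source \<Gamma> \<alpha>) \<and> (\<exists>\<alpha>. is_sink \<Gamma> \<alpha>)" if "finite (carrier W)"
  proof -
    obtain \<alpha>0 where \<alpha>0: "\<alpha>0 \<in> vertices \<Gamma>"
      using assms(5) unfolding connected_digraph_def connected_conv by blast
    have bound: "length ss \<le> Max (cox.len ` carrier W)"
      if "\<alpha> \<in> vertices \<Gamma>" "ascending ss \<alpha>" "set ss \<subseteq> S" for ss \<alpha>
    proof -
      have "cox.reduced (rev ss)"
        using reduced_if_ascending that by blast
      then have "length ss = cox.len (cox.list_prod (rev ss))"
        by (simp add: cox.reduced_def)
      moreover have "cox.list_prod (rev ss) \<in> carrier W"
        using that(3) cox.words_closed[of "rev ss"] by (intro cox.list_prod_closed) simp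
      ultimately show ?thesis
        using \<open>finite (carrier W)\<close> by simp
    qed
    \<comment> \<open>Without a sink, paths extend forwards beyond the bound; without a source, backwards.\<close>
    have "\<exists>\<alpha>. is_sink \<Gamma> \<alpha>"
    proof (rule ccontr)
      assume "\<not> ?thesis"
      then have "\<exists>s\<in>S. outgoing \<Gamma> s \<alpha>" if "\<alpha> \<in> vertices \<Gamma>" for \<alpha>
        using that by (auto simp: is_sink_iff step_def)
      then have "\<exists>ss. length ss = k \<and> ascending ss \<alpha>0 \<and> set ss \<subseteq> S" for k
      proof (induction k)
        case (Suc k)
        then obtain ss where ss: "length ss = k" "ascending ss \<alpha>0" "set ss \<subseteq> S"
          by blast
        then obtain s where "s \<in> S" "outgoing \<Gamma> s (fold (neighbour \<Gamma>) ss \<alpha>0)"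
          using Suc.prems fold_nbr_closed \<alpha>0 by blast
        then show ?case
          using ss by (intro exI[of _ "ss @ [s]"]) (simp add: ascending_append)
      qed simp
      then show False
        using bound[OF \<alpha>0] not_less_eq_eq by metis
    qed
    moreover have "\<exists>\<alpha>. is_source \<Gamma> \<alpha>"
    proof (rule ccontr)
      assume none: "\<not> ?thesis"
      have "\<exists>s\<in>S. \<not> outgoing \<Gamma> s \<alpha>" if \<alpha>: "\<alpha> \<in> vertices \<Gamma>" for \<alpha>
      proof -
        obtain \<beta> s where "\<beta> \<in> vertices \<Gamma>" "s \<in> S" "outgoing \<Gamma> s \<beta>" "\<alpha> = neighbour \<Gamma> s \<beta>"
          using none \<alpha> by (auto simp: is_source_iff step_def)
        then show ?thesis
          using out_nbr by auto
      qed
      then have "\<exists>\<alpha>\<in>vertices \<Gamma>. \<exists>ss. length ss = k \<and> ascending ss \<alpha> \<and> set ss \<subseteq> S" for k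
      proof (induction k)
        case 0
        then show ?case
          using \<alpha>0 by auto
      next
        case (Suc k)
        then obtain \<alpha> ss where ss: "\<alpha> \<in> vertices \<Gamma>" "length ss = k" "ascending ss \<alpha>" "set ss \<subseteq> S"
          by blast
        obtain s where "s \<in> S" "\<not> outgoing \<Gamma> s \<alpha>"
          using Suc.prems ss(1) by blast
        then show ?case
          using ss by (intro bexI[of _ "neighbour \<Gamma> s \<alpha>"] exI[of _ "s # ss"])
            (simp_all add: out_nbr nbr_nbr nbr_closed)
      qed
      then show False
        using bound not_less_eq_eq by metis
    qed
    ultimately show ?thesis
      by blast
  qed
  show ?thesis
    using source_unique sink_unique acyclic finite_case by blast
qed

end
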